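(* Let $(W,S)$ be a Coxeter system, $\mathbb{F}$ a field, and $\mathbf{q}=(q_s\in\mathbb{F}: s\in S)$. If $\mathcal{H}(\mathbf{q})$ is collapse-free and commutative, then it is isomorphic to $\mathcal{H}(G,R)$ as an algebra, where $G$ is the underlying graph of the Coxeter diagram of $(W,S)$ and $R:=\{s\in S:q_s=-1\}$.
   Context: A Coxeter system $(W,S)$ has $S$ finite and $W=\langle S: s^2=1,\ (sts\cdots)_{m_{st}}=(tst\cdots)_{m_{st}}\ \forall s\ne t\in S\rangle$, where $m_{st}=m_{ts}\in\{2,3,\ldots\}\cup\{\infty\}$ and $(aba\cdots)_m$ denotes the alternating product of $m$ factors starting with $a$; no relation is imposed between $s$ and $t$ if $m_{st}=\infty$ (and $\infty$ is not odd). The Coxeter diagram is the edge-weighted graph with vertex set $S$ and an edge of weight $m_{st}$ between $s\neq t$ whenever $m_{st}\ge 3$. The Hecke algebra $\mathcal{H}(\mathbf{q})$ of $(W,S)$ with independent parameters $\mathbf{q}=(q_s\in\mathbb{F}:s\in S)$ is the unital associative $\mathbb{F}$-algebra generated by $\{T_s:s\in S\}$ subject to the quadratic relations $(T_s-1)(T_s+q_s)=0$ for all $s\in S$ and the braid relations $(T_sT_tT_s\cdots)_{m_{st}}=(T_tT_sT_t\cdots)_{m_{st}}$ for all $s\neq t$ in $S$ (none if $m_{st}=\infty$). It is collapse-free if, whenever $m_{st}$ is odd and $q_s\neq q_t$, at least one of $q_s$ and $q_t$ is $0$. For a simple graph $G$ with vertex set $V(G)$ and edge set $E(G)$, and $R\subseteq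 V(G)$, $\mathcal{H}(G,R)$ is the quotient of the polynomial algebra $\mathbb{F}[x_v:v\in V(G)]$ by the ideal generated by $\{x_r^2:r\in R\}\cup\{x_v^2-x_v:v\in V(G)\setminus R\}\cup\{x_ux_v:uv\in E(G)\}$. *)

theory Defs
  imports
    "HOL-Algebra.QuotRing"
    "HOL-Algebra.Module"
    "HOL-Algebra.Generated_Groups"
    "HOL-Library.Poly_Mapping"
    "HOL-Library.Extended_Nat"
begin

section \<open>Coxeter systems\<close>

text \<open>The word \<open>a b a ...\<close> with \<open>n\<close> letters.\<close>

primrec alt_word :: "'a \<Rightarrow> 'a \<Rightarrow> nat \<Rightarrow> 'a list" where
  "alt_word a b 0 = []"
| "alt_word a b (Suc n) = a # alt_word b a n"

definition word_prod :: "('a, 'x) monoid_scheme \<Rightarrow> 'a list \<Rightarrow> 'a" where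
  "word_prod M w = foldr (mult M) w (one M)"

text \<open>Values of \<open>m\<close> on the diagonal are irrelevant everywhere.\<close>

definition coxeter_matrix :: "'s set \<Rightarrow> ('s \<Rightarrow> 's \<Rightarrow> enat) \<Rightarrow> bool" where
  "coxeter_matrix S m \<longleftrightarrow>
     (\<forall>s\<in>S. \<forall>t\<in>S. s \<noteq> t \<longrightarrow> m s t = m t s \<and> 2 \<le> m s t)"

text \<open>The congruence on words generated by the defining relations of a Coxeter group. Since
  the relations \<open>s\<^sup>2 = 1\<close> make the generators invertible, inverse letters are not needed: the
  group with this presentation is the monoid with this presentation.\<close>

inductive coxeter_cong :: "'s set \<Rightarrow> ('s \<Rightarrow> 's \<Rightarrow> enat) \<Rightarrow> 's list \<Rightarrow> 's list \<Rightarrow> bool"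
  for S m where
  refl: "coxeter_cong S m u u"
| sym: "coxeter_cong S m u v \<Longrightarrow> coxeter_cong S m v u"
| trans: "coxeter_cong S m u v \<Longrightarrow> coxeter_cong S m v w \<Longrightarrow> coxeter_cong S m u w"
| square: "s \<in> S \<Longrightarrow> coxeter_cong S m (u @ [s, s] @ v) (u @ v)"
| braid: "s \<in> S \<Longrightarrow> t \<in> S \<Longrightarrow> s \<noteq> t \<Longrightarrow> m s t = enat k \<Longrightarrow>
    coxeter_cong S m (u @ alt_word s t k @ v) (u @ alt_word t s k @ v)"

text \<open>\<open>W\<close> is presented by its finite subset \<open>S\<close>: it is generated by \<open>S\<close>, and two words
  in \<open>S\<close> have the same value in \<open>W\<close> iff this follows from the defining relations.\<close>

definition coxeter_system ::
    "('w, 'x) monoid_scheme \<Rightarrow> 'w set \<Rightarrow> ('w \<Rightarrow> 'w \<Rightarrow> enat) \<Rightarrow> bool" where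
  "coxeter_system W S m \<longleftrightarrow>
     group W \<and> finite S \<and> S \<subseteq> carrier W \<and> coxeter_matrix S m \<and>
     generate W S = carrier W \<and>
     (\<forall>u\<in>lists S. \<forall>v\<in>lists S. word_prod W u = word_prod W v \<longleftrightarrow> coxeter_cong S m u v)"

text \<open>A simple graph is a pair of its vertex set and its set of two-element edges.\<close>

definition coxeter_graph :: "'s set \<Rightarrow> ('s \<Rightarrow> 's \<Rightarrow> enat) \<Rightarrow> 's set \<times> 's set set" where
  "coxeter_graph S m = (S, {{s, t} | s t. s \<in> S \<and> t \<in> S \<and> s \<noteq> t \<and> 3 \<le> m s t})"


section \<open>Algebras over a field\<close>

text \<open>An algebra over the field \<open>'k\<close> is a \<^typ>\<open>('k, 'a) module\<close> record, the scalars being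
  all of the type \<open>'k\<close>. Polynomials in \<open>Poly_Mapping\<close> are finitely supported functions on a
  monoid written additively, multiplied by convolution; the elements supported on a submonoid
  \<open>M\<close> form the monoid algebra of \<open>M\<close>.\<close>

definition monoid_algebra :: "'m::monoid_add set \<Rightarrow> ('k::field, 'm \<Rightarrow>\<^sub>0 'k) module" where
  "monoid_algebra M =
    \<lparr>carrier = {p. Poly_Mapping.keys p \<subseteq> M}, mult = (*), one = 1, zero = 0, add = (+),
     smult = (\<lambda>c p. Poly_Mapping.single 0 c * p)\<rparr>"

datatype 'a free_monoid = Word (letters: "'a list")

instantiation free_monoid :: (type) monoid_add
begin

definition zero_free_monoid :: "'a free_monoid" where
  "0 = Word []"

definition plus_free_monoid :: "'a free_monoid \<Rightarrow> 'a free_monoid \<Rightarrow> 'a free_monoid" where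
  "u + v = Word (letters u @ letters v)"

instance
  by standard (simp_all add: zero_free_monoid_def plus_free_monoid_def)

end

text \<open>The free associative algebra on the set \<open>S\<close> and its generators.\<close>

definition free_algebra :: "'s set \<Rightarrow> ('k::field, 's free_monoid \<Rightarrow>\<^sub>0 'k) module" where
  "free_algebra S = monoid_algebra {w. letters w \<in> lists S}"

definition free_gen :: "'s \<Rightarrow> ('s free_monoid \<Rightarrow>\<^sub>0 'k::field)" where
  "free_gen s = Poly_Mapping.single (Word [s]) 1"

text \<open>The polynomial algebra in commuting variables indexed by \<open>V\<close> and its variables.\<close>

definition poly_algebra :: "'v set \<Rightarrow> ('k::field, ('v \<Rightarrow>\<^sub>0 nat) \<Rightarrow>\<^sub>0 'k) module" where
  "poly_algebra V = monoid_algebra {e. Poly_Mapping.keys e \<subseteq> V}"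

definition poly_var :: "'v \<Rightarrow> (('v \<Rightarrow>\<^sub>0 nat) \<Rightarrow>\<^sub>0 'k::field)" where
  "poly_var v = Poly_Mapping.single (Poly_Mapping.single v 1) 1"

text \<open>The quotient by a two-sided ideal. Scalar multiplication of cosets is given in the style of
  \<^const>\<open>rcoset_mult\<close>; the image \<open>{c x | x \<in> X}\<close> would not be a coset for \<open>c = 0\<close>.\<close>

definition quot_algebra :: "('k, 'a) module \<Rightarrow> 'a set \<Rightarrow> ('k, 'a set) module" where
  "quot_algebra A I =
     ring.extend (A Quot I) (module.fields (\<lambda>c X. \<Union>x\<in>X. I +>\<^bsub>A\<^esub> (c \<odot>\<^bsub>A\<^esub> x)))"

definition algebra_iso :: "('k, 'a) module \<Rightarrow> ('k, 'b) module \<Rightarrow> ('a \<Rightarrow> 'b) set" where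
  "algebra_iso A B =
     {h \<in> ring_iso A B. \<forall>c. \<forall>x\<in>carrier A. h (c \<odot>\<^bsub>A\<^esub> x) = c \<odot>\<^bsub>B\<^esub> h x}"


section \<open>Hecke algebras with independent parameters\<close>

text \<open>A relation \<open>a = b\<close> is represented by \<open>a - b\<close>. The constant \<open>q s\<close> is
  \<^term>\<open>Poly_Mapping.single 0 (q s)\<close>.\<close>

definition hecke_relations ::
    "'s set \<Rightarrow> ('s \<Rightarrow> 's \<Rightarrow> enat) \<Rightarrow> ('s \<Rightarrow> 'k::field) \<Rightarrow> ('s free_monoid \<Rightarrow>\<^sub>0 'k) set" where
  "hecke_relations S m q =
     {(free_gen s - 1) * (free_gen s + Poly_Mapping.single 0 (q s)) | s. s \<in> S} \<union>
     {prod_list (map free_gen (alt_word s t k)) - prod_list (map free_gen (alt_word t s k)) | s t k.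
        s \<in> S \<and> t \<in> S \<and> s \<noteq> t \<and> m s t = enat k}"

definition hecke_algebra ::
    "'s set \<Rightarrow> ('s \<Rightarrow> 's \<Rightarrow> enat) \<Rightarrow> ('s \<Rightarrow> 'k::field) \<Rightarrow> ('k, ('s free_monoid \<Rightarrow>\<^sub>0 'k) set) module" where
  "hecke_algebra S m q =
     quot_algebra (free_algebra S) (genideal (free_algebra S) (hecke_relations S m q))"

definition collapse_free ::
    "'s set \<Rightarrow> ('s \<Rightarrow> 's \<Rightarrow> enat) \<Rightarrow> ('s \<Rightarrow> 'k::field) \<Rightarrow> bool" where
  "collapse_free S m q \<longleftrightarrow>
     (\<forall>s\<in>S. \<forall>t\<in>S. \<forall>k. s \<noteq> t \<and> m s t = enat k \<and> odd k \<and> q s \<noteq> q t \<longrightarrow> q s = 0 \<or> q t = 0)"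

definition graph_relations ::
    "'v set \<times> 'v set set \<Rightarrow> 'v set \<Rightarrow> (('v \<Rightarrow>\<^sub>0 nat) \<Rightarrow>\<^sub>0 'k::field) set" where
  "graph_relations G R =
     {(poly_var r)\<^sup>2 | r. r \<in> R} \<union>
     {(poly_var v)\<^sup>2 - poly_var v | v. v \<in> fst G - R} \<union>
     {poly_var u * poly_var v | u v. {u, v} \<in> snd G}"

definition graph_algebra ::
    "'v set \<times> 'v set set \<Rightarrow> 'v set \<Rightarrow> ('k::field, (('v \<Rightarrow>\<^sub>0 nat) \<Rightarrow>\<^sub>0 'k) set) module" where
  "graph_algebra G R =
     quot_algebra (poly_algebra (fst G)) (genideal (poly_algebra (fst G)) (graph_relations G R))"


section \<open>Well-definedness\<close>

lemma ring_monoid_algebra: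
  assumes "0 \<in> M" and "\<And>u v. u \<in> M \<Longrightarrow> v \<in> M \<Longrightarrow> u + v \<in> M"
  shows "ring (monoid_algebra M :: ('k::field, 'm::monoid_add \<Rightarrow>\<^sub>0 'k) module)"
proof (rule ringI)
  have add: "Poly_Mapping.keys (x + y) \<subseteq> M"
    if "Poly_Mapping.keys x \<subseteq> M" "Poly_Mapping.keys y \<subseteq> M" for x y :: "'m \<Rightarrow>\<^sub>0 'k"
    using that keys_add[of x y] by blast
  have mult: "Poly_Mapping.keys (x * y) \<subseteq> M"
    if "Poly_Mapping.keys x \<subseteq> M" "Poly_Mapping.keys y \<subseteq> M" for x y :: "'m \<Rightarrow>\<^sub>0 'k"
    using that keys_mult[of x y] assms(2) by blast
  show "abelian_group (monoid_algebra M :: ('k, 'm \<Rightarrow>\<^sub>0 'k) module)"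
  proof (rule abelian_groupI)
    fix x :: "'m \<Rightarrow>\<^sub>0 'k" assume "x \<in> carrier (monoid_algebra M :: ('k, 'm \<Rightarrow>\<^sub>0 'k) module)"
    then show "\<exists>y\<in>carrier (monoid_algebra M :: ('k, 'm \<Rightarrow>\<^sub>0 'k) module).
        y \<oplus>\<^bsub>(monoid_algebra M :: ('k, 'm \<Rightarrow>\<^sub>0 'k) module)\<^esub> x =
        \<zero>\<^bsub>(monoid_algebra M :: ('k, 'm \<Rightarrow>\<^sub>0 'k) module)\<^esub>"
      by (intro bexI[of _ "- x"]) (auto simp: monoid_algebra_def)
  qed (auto simp: monoid_algebra_def add_ac dest: add[THEN subsetD, rotated 2])
  show "Group.monoid (monoid_algebra M :: ('k, 'm \<Rightarrow>\<^sub>0 'k) module)"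
    by (rule monoidI)
      (auto simp: monoid_algebra_def mult.assoc assms(1) dest: mult[THEN subsetD, rotated 2])
qed (auto simp: monoid_algebra_def distrib_left distrib_right)

lemma ring_free_algebra: "ring (free_algebra S)"
  unfolding free_algebra_def
  by (rule ring_monoid_algebra) (auto simp: zero_free_monoid_def plus_free_monoid_def)

lemma ring_poly_algebra: "ring (poly_algebra V)"
  unfolding poly_algebra_def
  by (rule ring_monoid_algebra) (use keys_add in fastforce)+

lemma hecke_relations_closed:
  "hecke_relations S m q \<subseteq> carrier (free_algebra S :: ('k::field, 's free_monoid \<Rightarrow>\<^sub>0 'k) module)"
proof -
  let ?F = "free_algebra S :: ('k, 's free_monoid \<Rightarrow>\<^sub>0 'k) module"
  interpret ring ?F by (rule ring_free_algebra)
  have one: "1 \<in> carrier ?F"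
    using one_closed by (simp add: free_algebra_def monoid_algebra_def)
  have add: "p + r \<in> carrier ?F" if "p \<in> carrier ?F" "r \<in> carrier ?F" for p r
    using a_closed[OF that] by (simp add: free_algebra_def monoid_algebra_def)
  have mult: "p * r \<in> carrier ?F" if "p \<in> carrier ?F" "r \<in> carrier ?F" for p r
    using m_closed[OF that] by (simp add: free_algebra_def monoid_algebra_def)
  have minus: "p - r \<in> carrier ?F" if "p \<in> carrier ?F" "r \<in> carrier ?F" for p r
    using that keys_diff[of p r] by (auto simp: free_algebra_def monoid_algebra_def)
  have const: "Poly_Mapping.single 0 c \<in> carrier ?F" for c
    by (auto simp: free_algebra_def monoid_algebra_def zero_free_monoid_def)
  have gen: "free_gen s \<in> carrier ?F" if "s \<in> S" for s
    using that by (auto simp: free_algebra_def monoid_algebra_def free_gen_def)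
  have word: "prod_list (map free_gen (alt_word s t k)) \<in> carrier ?F" if "s \<in> S" "t \<in> S" for s t k
    using that by (induction k arbitrary: s t) (simp_all add: one mult gen)
  show ?thesis
    unfolding hecke_relations_def
    by (auto intro!: mult minus add const word one gen)
qed

lemma graph_relations_closed:
  assumes "R \<subseteq> V" and "\<Union>E \<subseteq> V"
  shows "graph_relations (V, E) R \<subseteq> carrier (poly_algebra V :: ('k::field, ('v \<Rightarrow>\<^sub>0 nat) \<Rightarrow>\<^sub>0 'k) module)"
proof -
  let ?P = "poly_algebra V :: ('k, ('v \<Rightarrow>\<^sub>0 nat) \<Rightarrow>\<^sub>0 'k) module"
  interpret ring ?P by (rule ring_poly_algebra)
  have mult: "p * r \<in> carrier ?P" if "p \<in> carrier ?P" "r \<in> carrier ?P" for p r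
    using m_closed[OF that] by (simp add: poly_algebra_def monoid_algebra_def)
  have minus: "p - r \<in> carrier ?P" if "p \<in> carrier ?P" "r \<in> carrier ?P" for p r
    using that keys_diff[of p r] by (auto simp: poly_algebra_def monoid_algebra_def)
  have var: "poly_var v \<in> carrier ?P" if "v \<in> V" for v
    using that by (auto simp: poly_algebra_def monoid_algebra_def poly_var_def)
  show ?thesis
  proof
    fix p :: "('v \<Rightarrow>\<^sub>0 nat) \<Rightarrow>\<^sub>0 'k" assume "p \<in> graph_relations (V, E) R"
    then consider r where "r \<in> R" "p = (poly_var r)\<^sup>2"
      | v where "v \<in> V" "p = (poly_var v)\<^sup>2 - poly_var v"
      | u v where "{u, v} \<in> E" "p = poly_var u * poly_var v"
      unfolding graph_relations_def by auto
    then show "p \<in> carrier ?P"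
    proof cases
      case 1
      then show ?thesis using mult[OF var var] assms(1) by (auto simp only: power2_eq_square)
    next
      case 2
      then show ?thesis using minus[OF mult[OF var var] var] by (simp only: power2_eq_square)
    next
      case 3
      then have "u \<in> V" "v \<in> V" using assms(2) by auto
      with 3 show ?thesis using mult[OF var var] by (simp only:)
    qed
  qed
qed

lemma quot_algebra_smult_rcos:
  fixes M :: "'m::monoid_add set" and c :: "'k::field"
  defines "A \<equiv> monoid_algebra M :: ('k, 'm \<Rightarrow>\<^sub>0 'k) module"
  assumes "0 \<in> M" and "ideal I A" and "x \<in> carrier A"
  shows "c \<odot>\<^bsub>quot_algebra A I\<^esub> (I +>\<^bsub>A\<^esub> x) = I +>\<^bsub>A\<^esub> (c \<odot>\<^bsub>A\<^esub> x)"
proof -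
  interpret ideal I A by fact
  let ?k = "Poly_Mapping.single 0 c :: 'm \<Rightarrow>\<^sub>0 'k"
  have k: "?k \<in> carrier A"
    using \<open>0 \<in> M\<close> by (auto simp: A_def monoid_algebra_def)
  have smult: "c \<odot>\<^bsub>A\<^esub> y = ?k \<otimes>\<^bsub>A\<^esub> y" for y
    by (simp add: A_def monoid_algebra_def)
  have "I +>\<^bsub>A\<^esub> (c \<odot>\<^bsub>A\<^esub> y) = I +>\<^bsub>A\<^esub> (c \<odot>\<^bsub>A\<^esub> x)" if y: "y \<in> I +>\<^bsub>A\<^esub> x" for y
  proof -
    have "y \<in> carrier A"
      using y \<open>x \<in> carrier A\<close> a_r_coset_subset_G[OF a_subset] by blast
    moreover have "I +>\<^bsub>A\<^esub> y = I +>\<^bsub>A\<^esub> x"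
      using a_repr_independence'[OF y \<open>x \<in> carrier A\<close>] by simp
    ultimately show ?thesis
      using rcoset_mult_add[OF k, of x] rcoset_mult_add[OF k, of y] \<open>x \<in> carrier A\<close>
      unfolding smult by simp
  qed
  then have "(\<Union>y\<in>I +>\<^bsub>A\<^esub> x. I +>\<^bsub>A\<^esub> (c \<odot>\<^bsub>A\<^esub> y)) = (\<Union>y\<in>I +>\<^bsub>A\<^esub> x. I +>\<^bsub>A\<^esub> (c \<odot>\<^bsub>A\<^esub> x))"
    by (rule SUP_cong[OF HOL.refl])
  also have "\<dots> = I +>\<^bsub>A\<^esub> (c \<odot>\<^bsub>A\<^esub> x)"
    using a_rcos_self[OF \<open>x \<in> carrier A\<close>] by (intro cSUP_const) blast
  finally show ?thesis
    by (simp only: quot_algebra_def ring.defs module.defs module.simps)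
qed

end

theory Submission
  imports
    Defs
    "HOL-Library.Function_Algebras"
    "HOL-Algebra.Algebraic_Closure_Type"
begin

text \<open>
  Let \<open>m\<^sub>s\<^sub>t \<ge> 3\<close>. If \<open>T\<^sub>s\<close> and \<open>T\<^sub>t\<close> commute, then \<open>m\<^sub>s\<^sub>t\<close> is odd and exactly one of \<open>q\<^sub>s, q\<^sub>t\<close> vanishes:
  otherwise there is a representation in which they do not commute, built like the reflection
  representation. Generators with nonzero parameter act by \<open>1 - X\<^sub>u\<close>, where \<open>X\<^sub>u\<close> has rank one with
  \<open>X\<^sub>u\<^sup>2 = (1 + q\<^sub>u) X\<^sub>u\<close> and \<open>X\<^sub>u X\<^sub>v X\<^sub>u = c\<^sub>u\<^sub>v X\<^sub>u\<close>; for these the braid relation is a polynomial condition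
  on \<open>c\<^sub>u\<^sub>v\<close>, which is solvable over the algebraic closure. Generators with parameter \<open>0\<close> act by \<open>0\<close>,
  except that \<open>T\<^sub>s\<close> or \<open>T\<^sub>t\<close> acts by \<open>X\<^sub>s\<close> or \<open>X\<^sub>t\<close> if its parameter is \<open>0\<close>. No linear basis of the Hecke
  algebra indexed by \<open>W\<close> is needed.

  Hence in the commutative case the braid relation along an edge with \<open>q\<^sub>s = 0 \<noteq> q\<^sub>t\<close> reads
  \<open>T\<^sub>s\<^sup>j\<^sup>+\<^sup>1 T\<^sub>t\<^sup>j = T\<^sub>s\<^sup>j T\<^sub>t\<^sup>j\<^sup>+\<^sup>1\<close> with \<open>j \<ge> 1\<close>. Since \<open>T\<^sub>s\<close> is idempotent and \<open>T\<^sub>t\<close> invertible, this is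
  equivalent to \<open>T\<^sub>s (1 - T\<^sub>t) = 0\<close>, and an affine change of generators carries the relations of one
  algebra to those of the other.
\<close>

section \<open>Modules over the free algebra\<close>

lemma sum_single_keys: "(\<Sum>w\<in>Poly_Mapping.keys p. Poly_Mapping.single w (Poly_Mapping.lookup p w)) = p"
proof (rule poly_mapping_eqI)
  fix v
  show "Poly_Mapping.lookup (\<Sum>w\<in>Poly_Mapping.keys p. Poly_Mapping.single w (Poly_Mapping.lookup p w)) v
      = Poly_Mapping.lookup p v"
    by (auto simp: lookup_sum lookup_single when_def sum.delta in_keys_iff)
qed

text \<open>Monomials generate the additive group. Only additivity is assumed, so the principle
  serves module actions and algebra homomorphisms alike.\<close>

lemma additive_eqI:
  fixes f g :: "('m \<Rightarrow>\<^sub>0 'k::ab_group_add) \<Rightarrow> 'v::ab_group_add"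
  assumes f: "additive f" and g: "additive g"
    and eq: "\<And>w c. f (Poly_Mapping.single w c) = g (Poly_Mapping.single w c)"
  shows "f p = g p"
proof -
  have "f p = (\<Sum>w\<in>Poly_Mapping.keys p. f (Poly_Mapping.single w (Poly_Mapping.lookup p w)))"
    by (subst sum_single_keys[of p, symmetric]) (rule additive.sum[OF f])
  also have "\<dots> = (\<Sum>w\<in>Poly_Mapping.keys p. g (Poly_Mapping.single w (Poly_Mapping.lookup p w)))"
    by (simp add: eq)
  also have "\<dots> = g p"
    by (subst (3) sum_single_keys[of p, symmetric]) (rule additive.sum[OF g, symmetric])
  finally show ?thesis .
qed

text \<open>The coefficient is an argument of \<open>F\<close>, so the target needs no scalar
  multiplication.\<close>

definition lin_ext :: "('m \<Rightarrow> 'k \<Rightarrow> 'v) \<Rightarrow> ('m \<Rightarrow>\<^sub>0 'k::ab_group_add) \<Rightarrow> 'v::ab_group_add" where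
  "lin_ext F p = (\<Sum>w\<in>Poly_Mapping.keys p. F w (Poly_Mapping.lookup p w))"

lemma lin_ext_superset:
  assumes "\<And>w. F w 0 = 0" "finite K" "Poly_Mapping.keys p \<subseteq> K"
  shows "lin_ext F p = (\<Sum>w\<in>K. F w (Poly_Mapping.lookup p w))"
  unfolding lin_ext_def using assms
  by (intro sum.mono_neutral_left) (auto simp: in_keys_iff)

lemma additive_lin_ext:
  assumes "\<And>w. additive (F w)"
  shows "additive (lin_ext F)"
proof
  fix p r :: "'a \<Rightarrow>\<^sub>0 'b"
  have 0: "F w 0 = 0" for w by (rule additive.zero[OF assms])
  let ?K = "Poly_Mapping.keys p \<union> Poly_Mapping.keys r"
  have "lin_ext F x = (\<Sum>w\<in>?K. F w (Poly_Mapping.lookup x w))" if "x \<in> {p, r, p + r}" for x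
    using that keys_add[of p r] by (intro lin_ext_superset 0) auto
  then show "lin_ext F (p + r) = lin_ext F p + lin_ext F r"
    by (simp add: lookup_add additive.add[OF assms] sum.distrib)
qed

lemma lin_ext_single:
  assumes "F w 0 = 0"
  shows "lin_ext F (Poly_Mapping.single w c) = F w c"
  by (cases "c = 0") (simp_all add: lin_ext_def assms)


locale free_algebra_rep = module scale
  for scale :: "'k::field \<Rightarrow> 'v::ab_group_add \<Rightarrow> 'v" +
  fixes \<rho> :: "'s \<Rightarrow> 'v \<Rightarrow> 'v"
  assumes rep_hom: "module_hom scale scale (\<rho> s)"
begin

definition act :: "('s free_monoid \<Rightarrow>\<^sub>0 'k) \<Rightarrow> 'v \<Rightarrow> 'v" where
  "act p x = lin_ext (\<lambda>w c. scale c (foldr \<rho> (letters w) x)) p"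

lemma word_hom: "module_hom scale scale (foldr \<rho> w)"
proof (induction w)
  case Nil
  then show ?case by unfold_locales auto
next
  case (Cons s w)
  interpret a: module_hom scale scale "foldr \<rho> w" by fact
  interpret b: module_hom scale scale "\<rho> s" by (rule rep_hom)
  show ?case by unfold_locales (auto simp: a.add b.add a.scale b.scale)
qed

lemmas word_add = module_hom.add[OF word_hom]
  and word_scale = module_hom.scale[OF word_hom]

lemma act_single [simp]: "act (Poly_Mapping.single w c) x = scale c (foldr \<rho> (letters w) x)"
  by (simp add: act_def lin_ext_single)

lemma additive_act: "additive (\<lambda>p. act p x)"
  unfolding act_def by (rule additive_lin_ext) (simp add: additive_def scale_left_distrib)

lemmas act_add = additive.add[OF additive_act]
  and act_diff = additive.diff[OF additive_act]
  and act_zero [simp] = additive.zero[OF additive_act]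

lemma additive_act': "additive (act p)"
  by unfold_locales (simp add: act_def lin_ext_def word_add scale_right_distrib sum.distrib)

text \<open>Reduction to monomials, first in \<open>r\<close> and then in \<open>p\<close>; there,
  concatenation of words becomes composition of maps.\<close>

lemma act_mult: "act (p * r) x = act p (act r x)"
proof -
  have 1: "act (Poly_Mapping.single w c * r) x = act (Poly_Mapping.single w c) (act r x)" for w c
  proof (rule additive_eqI[where f = "\<lambda>r. act (Poly_Mapping.single w c * r) x"])
    show "additive (\<lambda>r. act (Poly_Mapping.single w c * r) x)"
      by unfold_locales (simp add: distrib_left act_add)
    show "additive (\<lambda>r. act (Poly_Mapping.single w c) (act r x))"
      by unfold_locales (simp only: act_add additive.add[OF additive_act'])
  qed (simp add: mult_single plus_free_monoid_def word_scale)
  show ?thesis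
  proof (rule additive_eqI[where f = "\<lambda>p. act (p * r) x"])
    show "additive (\<lambda>p. act (p * r) x)"
      by unfold_locales (simp add: distrib_right act_add)
  qed (use 1 additive_act in auto)
qed

lemma act_const: "act (Poly_Mapping.single 0 c) x = scale c x"
  by (simp add: zero_free_monoid_def)

lemma act_one [simp]: "act 1 x = x"
  using act_const[of 1 x] by simp

lemma act_gen [simp]: "act (free_gen s) x = \<rho> s x"
  by (simp add: free_gen_def)

lemma act_word: "act (prod_list (map free_gen w)) x = foldr \<rho> w x"
  by (induction w) (simp_all add: act_mult)

end

section \<open>Carriers and ideals of monoid algebras\<close>

lemma monoid_algebra_simps [simp]:
  "\<one>\<^bsub>monoid_algebra M\<^esub> = 1" "\<zero>\<^bsub>monoid_algebra M\<^esub> = 0"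
  "p \<otimes>\<^bsub>monoid_algebra M\<^esub> r = p * r" "p \<oplus>\<^bsub>monoid_algebra M\<^esub> r = p + r"
  "c \<odot>\<^bsub>monoid_algebra M\<^esub> p = Poly_Mapping.single 0 c * p"
  "p \<in> carrier (monoid_algebra M) \<longleftrightarrow> Poly_Mapping.keys p \<subseteq> M"
  by (simp_all add: monoid_algebra_def)

locale submonoid_algebra =
  fixes M :: "'m::monoid_add set" and A :: "('k::field, 'm \<Rightarrow>\<^sub>0 'k) module"
  assumes zero_mem: "0 \<in> M" and add_mem: "\<And>u v. u \<in> M \<Longrightarrow> v \<in> M \<Longrightarrow> u + v \<in> M"
    and A_eq: "A = monoid_algebra M"
begin

lemma ring_A: "ring A"
  unfolding A_eq by (rule ring_monoid_algebra[OF zero_mem add_mem])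

sublocale ring A by (rule ring_A)

lemma A_simps [simp]:
  "\<one>\<^bsub>A\<^esub> = 1" "\<zero>\<^bsub>A\<^esub> = 0" "p \<otimes>\<^bsub>A\<^esub> r = p * r" "p \<oplus>\<^bsub>A\<^esub> r = p + r"
  "c \<odot>\<^bsub>A\<^esub> p = Poly_Mapping.single 0 c * p"
  by (simp_all add: A_eq)

lemma mem_iff: "p \<in> carrier A \<longleftrightarrow> Poly_Mapping.keys p \<subseteq> M"
  by (simp add: A_eq)

lemma zero_in [simp]: "0 \<in> carrier A" and one_in [simp]: "1 \<in> carrier A"
  using zero_closed one_closed by simp_all

lemma add_in [simp]: "p \<in> carrier A \<Longrightarrow> r \<in> carrier A \<Longrightarrow> p + r \<in> carrier A"
  and mult_in [simp]: "p \<in> carrier A \<Longrightarrow> r \<in> carrier A \<Longrightarrow> p * r \<in> carrier A"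
  using a_closed[of p r] m_closed[of p r] by simp_all

lemma single_in: "w \<in> M \<Longrightarrow> Poly_Mapping.single w c \<in> carrier A"
  by (auto simp: mem_iff)

lemma const_in [simp]: "Poly_Mapping.single 0 c \<in> carrier A"
  by (simp add: single_in zero_mem)

lemma uminus_in [simp]: "p \<in> carrier A \<Longrightarrow> - p \<in> carrier A"
  by (simp add: mem_iff)

lemma diff_in [simp]: "p \<in> carrier A \<Longrightarrow> r \<in> carrier A \<Longrightarrow> p - r \<in> carrier A"
  using add_in[of p "- r"] by simp

lemma power_in [simp]: "p \<in> carrier A \<Longrightarrow> p ^ n \<in> carrier A"
  by (induction n) simp_all

lemma prod_list_in: "set ps \<subseteq> carrier A \<Longrightarrow> prod_list ps \<in> carrier A"
  by (induction ps) simp_all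

lemma sum_in: "(\<And>i. i \<in> B \<Longrightarrow> f i \<in> carrier A) \<Longrightarrow> sum f B \<in> carrier A"
  by (induction B rule: infinite_finite_induct) simp_all

lemma a_inv_A: "p \<in> carrier A \<Longrightarrow> \<ominus>\<^bsub>A\<^esub> p = - p"
  by (rule minus_equality) simp_all

lemma a_minus_A: "p \<in> carrier A \<Longrightarrow> r \<in> carrier A \<Longrightarrow> p \<ominus>\<^bsub>A\<^esub> r = p - r"
  by (simp add: a_minus_def a_inv_A)

text \<open>Closure under negation comes from multiplication by \<open>- 1\<close>.\<close>

lemma ideal_iff:
  "ideal I A \<longleftrightarrow> I \<subseteq> carrier A \<and> 0 \<in> I \<and> (\<forall>a\<in>I. \<forall>b\<in>I. a + b \<in> I) \<and>
     (\<forall>a\<in>I. \<forall>p\<in>carrier A. p * a \<in> I \<and> a * p \<in> I)" (is "_ \<longleftrightarrow> ?R")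
proof
  assume "ideal I A"
  then interpret ideal I A .
  show ?R
    using a_subset a_closed additive_subgroup.zero_closed[OF is_additive_subgroup]
      I_l_closed I_r_closed by auto
next
  assume R: ?R
  have neg: "- a \<in> I" if "a \<in> I" for a
  proof -
    have "(- 1) * a \<in> I" using R that uminus_in[OF one_in] by blast
    then show ?thesis by simp
  qed
  show "ideal I A"
  proof (rule idealI[OF ring_A])
    show "subgroup I (add_monoid A)"
    proof (rule add.subgroupI)
      show "\<ominus>\<^bsub>A\<^esub> a \<in> I" if "a \<in> I" for a
        using that neg R a_inv_A[of a] by auto
    qed (use R in auto)
  qed (use R in auto)
qed

context
  fixes I assumes I: "ideal I A"
begin

lemma ideal_subset: "a \<in> I \<Longrightarrow> a \<in> carrier A"
  and ideal_zero [simp]: "0 \<in> I"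
  and ideal_add: "a \<in> I \<Longrightarrow> b \<in> I \<Longrightarrow> a + b \<in> I"
  and ideal_lmult: "a \<in> I \<Longrightarrow> p \<in> carrier A \<Longrightarrow> p * a \<in> I"
  and ideal_rmult: "a \<in> I \<Longrightarrow> p \<in> carrier A \<Longrightarrow> a * p \<in> I"
  using I unfolding ideal_iff by auto

lemma ideal_uminus: "a \<in> I \<Longrightarrow> - a \<in> I"
  using ideal_lmult[of a "- 1"] by simp

lemma ideal_diff: "a \<in> I \<Longrightarrow> b \<in> I \<Longrightarrow> a - b \<in> I"
  using ideal_add[OF _ ideal_uminus, of a b] by simp

lemma ideal_sum: "(\<And>i. i \<in> B \<Longrightarrow> f i \<in> I) \<Longrightarrow> sum f B \<in> I"
  by (induction B rule: infinite_finite_induct) (simp_all add: ideal_add)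

lemma rcos_eq_iff:
  "p \<in> carrier A \<Longrightarrow> r \<in> carrier A \<Longrightarrow> I +>\<^bsub>A\<^esub> p = I +>\<^bsub>A\<^esub> r \<longleftrightarrow> p - r \<in> I"
  using quotient_eq_iff_same_a_r_cos[OF I, of p r] by (simp add: a_minus_A)

end

end

section \<open>Evaluation homomorphisms on the free algebra\<close>

lemma const_commute:
  fixes p :: "'m::monoid_add \<Rightarrow>\<^sub>0 'k::field"
  shows "Poly_Mapping.single 0 c * p = p * Poly_Mapping.single 0 c"
  by (rule additive_eqI[where p = p])
    (auto simp: additive_def distrib_left distrib_right mult_single mult.commute)

lemma free_submonoid_algebra: "submonoid_algebra {w. letters w \<in> lists S} (free_algebra S)"
  by unfold_locales (auto simp: free_algebra_def zero_free_monoid_def plus_free_monoid_def)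

lemma poly_submonoid_algebra: "submonoid_algebra {e. Poly_Mapping.keys e \<subseteq> V} (poly_algebra V)"
  by unfold_locales (use keys_add in \<open>fastforce simp: poly_algebra_def\<close>)+

text \<open>The algebra homomorphism with prescribed images of the generators, realised by letting
  the free algebra act through left multiplications and applying it to \<open>1\<close>.\<close>

definition ev :: "('s \<Rightarrow> ('m::monoid_add \<Rightarrow>\<^sub>0 'k)) \<Rightarrow> ('s free_monoid \<Rightarrow>\<^sub>0 'k::field) \<Rightarrow> ('m \<Rightarrow>\<^sub>0 'k)" where
  "ev y p = free_algebra_rep.act (\<lambda>c x. Poly_Mapping.single 0 c * x) (\<lambda>s x. y s * x) p 1"

lemma ev_rep: "free_algebra_rep (\<lambda>c x. Poly_Mapping.single 0 c * x) (\<lambda>s x. y s * x)"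
  for y :: "'s \<Rightarrow> ('m::monoid_add \<Rightarrow>\<^sub>0 'k::field)"
proof unfold_locales
  fix s c and p r :: "'m \<Rightarrow>\<^sub>0 'k"
  have "y s * (Poly_Mapping.single 0 c * p) = (y s * Poly_Mapping.single 0 c) * p"
    by (simp only: mult.assoc)
  also have "\<dots> = Poly_Mapping.single 0 c * (y s * p)"
    by (simp only: const_commute[symmetric] mult.assoc)
  finally show "y s * (Poly_Mapping.single 0 c * p) = Poly_Mapping.single 0 c * (y s * p)" .
qed (simp_all add: distrib_left distrib_right single_add mult_single mult.assoc[symmetric])

lemma
  fixes y :: "'s \<Rightarrow> ('m::monoid_add \<Rightarrow>\<^sub>0 'k::field)"
  shows ev_add: "ev y (p + r) = ev y p + ev y r"
    and ev_diff: "ev y (p - r) = ev y p - ev y r"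
    and ev_zero [simp]: "ev y 0 = 0"
    and ev_one [simp]: "ev y 1 = 1"
    and ev_gen [simp]: "ev y (free_gen s) = y s"
    and ev_const [simp]: "ev y (Poly_Mapping.single 0 c) = Poly_Mapping.single 0 c"
    and ev_mult: "ev y (p * r) = ev y p * ev y r"
    and ev_single: "ev y (Poly_Mapping.single w c) =
      Poly_Mapping.single 0 c * prod_list (map y (letters w))"
proof -
  interpret free_algebra_rep "\<lambda>c x. Poly_Mapping.single 0 c * x" "\<lambda>s x. y s * x"
    by (rule ev_rep)
  note [simp] = ev_def
  show "ev y (p + r) = ev y p + ev y r" "ev y (p - r) = ev y p - ev y r"
    "ev y 0 = 0" "ev y 1 = 1" "ev y (free_gen s) = y s"
    "ev y (Poly_Mapping.single 0 c) = Poly_Mapping.single 0 c"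
    by (simp_all add: act_add act_diff act_const del: act_single)
  have foldr: "foldr (\<lambda>s x. y s * x) l x = prod_list (map y l) * x" for l x
    by (induction l) (simp_all add: mult.assoc)
  show "ev y (Poly_Mapping.single w c) =
      Poly_Mapping.single 0 c * prod_list (map y (letters w))"
    by (simp add: foldr)
  \<comment> \<open>Left multiplications commute with right multiplication by \<open>x\<close>, so
    the value at \<open>1\<close> determines the action.\<close>
  have act1: "act p x = act p 1 * x" for p x
  proof (rule additive_eqI[where p = p])
    show "additive (\<lambda>p. act p x)" "additive (\<lambda>p. act p 1 * x)"
      by (simp_all add: additive_def act_add distrib_right)
  qed (simp only: act_single foldr mult.assoc mult_1_right)
  show "ev y (p * r) = ev y p * ev y r"
    unfolding ev_def act_mult by (rule act1)
qed

section \<open>Braid relations for rank one perturbations of the identity\<close>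

lemma foldr_alt_word_Suc_Suc:
  "foldr f (alt_word u v (Suc (Suc k))) x = f u (f v (foldr f (alt_word u v k) x))"
  by simp

lemma alt_word_commute:
  assumes comm: "\<And>x. f u (f v x) = f v (f u x)" and "even k"
  shows "foldr f (alt_word u v k) x = foldr f (alt_word v u k) x"
proof -
  have "foldr f (alt_word u v (2 * j)) x = foldr f (alt_word v u (2 * j)) x" for j
    by (induction j) (simp_all add: comm)
  with \<open>even k\<close> show ?thesis by (auto elim: evenE)
qed

text \<open>The idempotent \<open>f u\<close> absorbs \<open>f v\<close> on either side, so both
  words, containing each letter, collapse to \<open>f u\<close>.\<close>

lemma alt_word_absorb:
  assumes "\<And>x. f u (f v x) = f u x" "\<And>x. f v (f u x) = f u x" "\<And>x. f u (f u x) = f u x"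
    and "2 \<le> k"
  shows "foldr f (alt_word u v k) x = foldr f (alt_word v u k) x"
proof -
  have "foldr f (alt_word u v (k + 2)) x = f u x \<and> foldr f (alt_word v u (k + 2)) x = f u x" for k
  proof (induction k)
    case 0
    then show ?case using assms by (simp add: numeral_2_eq_2)
  next
    case (Suc k)
    then show ?case using assms by simp
  qed
  from this[of "k - 2"] \<open>2 \<le> k\<close> show ?thesis by (simp only: le_add_diff_inverse2)
qed

text \<open>The word starting with \<open>v\<close> contains \<open>u v u\<close> only from its
  second letter on, hence the bound \<open>4\<close>.\<close>

lemma alt_word_zero:
  assumes zero: "\<And>x. f u (f v (f u x)) = (0 :: 'v::zero)" "f u 0 = 0" "f v 0 = 0" and "3 \<le> k"
  shows "foldr f (alt_word u v k) x = 0" and "4 \<le> k \<Longrightarrow> foldr f (alt_word v u k) x = 0"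
proof -
  have *: "foldr f (alt_word u v (Suc (Suc (Suc k)))) x = 0" for k
    by (cases k) (simp_all add: zero)
  from *[of "k - 3"] \<open>3 \<le> k\<close> show "foldr f (alt_word u v k) x = 0"
    by (simp add: numeral_3_eq_3 Suc_diff_Suc)
  assume "4 \<le> k"
  then have "k = Suc (Suc (Suc (Suc (k - 4))))" by simp
  then show "foldr f (alt_word v u k) x = 0"
    using *[of "k - 4"] zero(3) by (metis alt_word.simps(2) foldr_Cons comp_apply)
qed

text \<open>These Chebyshev-like polynomials solve \<open>f\<^sub>n\<^sub>+\<^sub>2 = x f\<^sub>n\<^sub>+\<^sub>1 - d f\<^sub>n\<close>, the recurrence that the
  Cayley--Hamilton theorem gives for the defect of the braid relation.\<close>

fun recur_poly :: "'l::field \<Rightarrow> 'l \<Rightarrow> nat \<Rightarrow> 'l poly" where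
  "recur_poly g d 0 = 1"
| "recur_poly g d (Suc 0) = [:g, 1:]"
| "recur_poly g d (Suc (Suc n)) = pCons 0 (recur_poly g d (Suc n)) - smult d (recur_poly g d n)"

lemma recur_poly_monic: "coeff (recur_poly g d n) n = 1 \<and> (\<forall>k>n. coeff (recur_poly g d n) k = 0)"
proof (induction g d n rule: recur_poly.induct)
  case (3 g d n)
  then show ?case by (auto simp: coeff_pCons split: nat.split)
qed (auto simp: coeff_pCons split: nat.split)

lemma degree_recur_poly: "degree (recur_poly g d n) = n"
  using recur_poly_monic[of g d n]
  by (intro antisym degree_le le_degree) auto

text \<open>The recurrence determines \<open>f\<close> from its first two values; \<open>g\<close>
  encodes the start, which differs between even and odd word lengths.\<close>

lemma recur_poly_solution:
  assumes "f 1 = (x + g) * f 0" "\<And>n. f (Suc (Suc n)) = x * f (Suc n) - d * f n"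
  shows "f n = poly (recur_poly g d n) x * f 0"
  using assms
proof (induction g d n rule: recur_poly.induct)
  case (3 g d n)
  have "f (Suc (Suc n)) =
      x * (poly (recur_poly g d (Suc n)) x * f 0) - d * (poly (recur_poly g d n) x * f 0)"
    using 3 by simp
  then show ?case by (simp add: algebra_simps)
qed (simp_all add: algebra_simps)

text \<open>The value \<open>c\<close> for which \<open>1 - X\<close> and \<open>1 - Y\<close> satisfy the braid relation of length \<open>k\<close>, if
  \<open>X\<^sup>2 = (1 + a) X\<close>, \<open>Y\<^sup>2 = (1 + b) Y\<close> and \<open>X Y X = c X\<close>; the trace of \<open>(1 - X) (1 - Y)\<close> on the
  plane spanned by the two images is \<open>c - a - b\<close>.\<close>

definition braid_coeff :: "nat \<Rightarrow> 'l::field \<Rightarrow> 'l \<Rightarrow> 'l" where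
  "braid_coeff k a b = a + b +
     (SOME x. poly (recur_poly (if even k then 0 else a) (a * b) ((k - 1) div 2)) x = 0)"

text \<open>The bound \<open>3 \<le> k\<close> makes the degree \<open>(k - 1) div 2\<close>
  positive, so a root exists over an algebraically closed field.\<close>

lemma braid_coeff:
  fixes a b :: "'l::alg_closed_field"
  assumes "3 \<le> k"
  shows "poly (recur_poly (if even k then 0 else a) (a * b) ((k - 1) div 2)) (braid_coeff k a b - a - b) = 0"
proof -
  have "degree (recur_poly (if even k then 0 else a) (a * b) ((k - 1) div 2)) > 0"
    using assms by (simp add: degree_recur_poly)
  from someI_ex[OF alg_closed_imp_poly_has_root[OF this]] show ?thesis
    by (simp add: braid_coeff_def)
qed

locale rank_two =
  fixes f :: "'s \<Rightarrow> ('i \<Rightarrow> 'l::field) \<Rightarrow> 'i \<Rightarrow> 'l" and u v :: 's and e e' :: "'i \<Rightarrow> 'l" and i j a b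
  assumes fu: "f u y = (\<lambda>n. y n - e n * y i)" and fv: "f v y = (\<lambda>n. y n - e' n * y j)"
    and ei: "e i = 1 + a" and ej: "e' j = 1 + b"
begin

abbreviation "tr \<equiv> e j * e' i - a - b"

text \<open>The characteristic polynomial of \<open>f u\<close> after \<open>f v\<close> on the
  plane of \<open>e\<close> and \<open>e'\<close>, evaluated at this product; \<open>a * b\<close>
  is the determinant, the factors having \<open>- a\<close> and \<open>- b\<close>. It kills the
  plane, which contains \<open>f u y - y\<close> and \<open>f v y - y\<close>, so \<open>N\<close>
  does not change when \<open>f u\<close> or \<open>f v\<close> is applied first.\<close>

abbreviation "N y n \<equiv> f u (f v (f u (f v y))) n - tr * f u (f v y) n + a * b * y n"

lemma char_poly: "N y n = f v (f u (f v (f u y))) n - tr * f v (f u y) n + a * b * y n"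
  and char_poly_u: "N (f u y) n = N y n"
  and char_poly_v: "N (f v y) n = N y n"
  by (simp_all only: fu fv ei ej) (simp_all add: algebra_simps)

definition "D k y n = foldr f (alt_word u v k) y n - foldr f (alt_word v u k) y n"

text \<open>\<open>N\<close> agrees on the two words of length \<open>k\<close>, both values being
  \<open>N y\<close>. Expanding it with \<open>u\<close> first on one word and with \<open>v\<close>
  first on the other, then subtracting, gives the recurrence.\<close>

lemma D_recur: "D (Suc (Suc (Suc (Suc k)))) y n = tr * D (Suc (Suc k)) y n - a * b * D k y n"
proof -
  have "N (foldr f (alt_word u v k) y) n = N y n \<and> N (foldr f (alt_word v u k) y) n = N y n"
    by (induction k) (simp_all only: alt_word.simps foldr_Cons comp_apply foldr_Nil id_apply
        char_poly_u char_poly_v)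
  then have eq: "N (foldr f (alt_word u v k) y) n =
      f v (f u (f v (f u (foldr f (alt_word v u k) y)))) n
      - tr * f v (f u (foldr f (alt_word v u k) y)) n + a * b * foldr f (alt_word v u k) y n"
    using char_poly[of "foldr f (alt_word v u k) y" n] by simp
  have "p - p' = t * (r - r') - d * (z - z')"
    if "p - t * r + d * z = p' - t * r' + d * z'" for p p' t r r' d z z' :: 'l
    using that by (simp add: algebra_simps)
  from this[OF eq] show ?thesis by (simp only: D_def foldr_alt_word_Suc_Suc)
qed

text \<open>Since \<open>D 0\<close> vanishes, the recurrence starts at length \<open>2\<close> with
  \<open>g = 0\<close>.\<close>

lemma D_even: "D (2 * k + 2) y n = poly (recur_poly 0 (a * b) k) tr * D 2 y n"
proof -
  have "D 4 y n = tr * D 2 y n"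
    using D_recur[of 0] by (simp add: D_def numeral_eq_Suc)
  then show ?thesis
    using recur_poly_solution[of "\<lambda>k. D (2 * k + 2) y n" tr 0 "a * b" k] D_recur
    by (simp add: numeral_eq_Suc)
qed

text \<open>The hypothesis \<open>a = b\<close> makes \<open>D 3\<close> the multiple
  \<open>tr + a\<close> of \<open>D 1\<close>, hence \<open>g = a\<close>.\<close>

lemma D_odd:
  assumes "a = b"
  shows "D (2 * k + 1) y n = poly (recur_poly a (a * b) k) tr * D 1 y n"
proof -
  have "D 3 y n = (tr + a) * D 1 y n"
    unfolding D_def numeral_3_eq_3 using assms by (simp add: fu fv ei ej algebra_simps)
  then show ?thesis
    using recur_poly_solution[of "\<lambda>k. D (2 * k + 1) y n" tr a "a * b" k] D_recur
    by (simp add: numeral_eq_Suc)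
qed

text \<open>The lengths \<open>2 * l + 1\<close> and \<open>2 * l + 2\<close> share the index
  \<open>l = (k - 1) div 2\<close>.\<close>

lemma alt_word_eq:
  assumes root: "poly (recur_poly (if even k then 0 else a) (a * b) ((k - 1) div 2)) tr = 0"
    and "1 \<le> k" and "odd k \<Longrightarrow> a = b"
  shows "foldr f (alt_word u v k) y = foldr f (alt_word v u k) y"
proof -
  have "D k y n = 0" for n
  proof (cases "even k")
    case True
    with \<open>1 \<le> k\<close> obtain l where "k = 2 * l + 2"
      by (metis One_nat_def Suc_1 add_2_eq_Suc' dvd_def mult_Suc_right not0_implies_Suc
          not_one_le_zero mult_0_right add.commute)
    then show ?thesis using D_even[of l] root by simp
  next
    case False
    then obtain l where "k = 2 * l + 1" by (elim oddE)
    then show ?thesis using D_odd[of l] root False assms(3) by simp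
  qed
  then show ?thesis by (auto simp: D_def)
qed

end

lemma square_root_exists: "\<exists>d :: 'l::alg_closed_field. d * d = c"
proof -
  have "\<exists>x. poly [:-c, 0, 1:] x = 0"
    by (rule alg_closed_imp_poly_has_root) simp
  then show ?thesis by (auto simp: eq_neg_iff_add_eq_0 intro: exI)
qed

text \<open>One fixed root serves as entry for both \<open>(u, v)\<close> and \<open>(v, u)\<close>,
  so that their product is \<open>c\<close>.\<close>

definition some_sqrt :: "'l::alg_closed_field \<Rightarrow> 'l" where
  "some_sqrt c = (SOME d. d * d = c)"

lemma some_sqrt: "some_sqrt c * some_sqrt c = c"
  unfolding some_sqrt_def by (rule someI_ex[OF square_root_exists])

section \<open>A representation with two noncommuting generators\<close>

text \<open>The situation that commutativity must exclude: an edge that is not of odd weight with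
  exactly one vanishing parameter.\<close>

locale hecke_pair =
  fixes S :: "'s set" and m :: "'s \<Rightarrow> 's \<Rightarrow> enat" and q :: "'s \<Rightarrow> 'k::field" and s t :: 's
  assumes matrix: "coxeter_matrix S m" and collapse_free: "collapse_free S m q"
    and s: "s \<in> S" and t: "t \<in> S" and st: "s \<noteq> t" and m_ge: "3 \<le> m s t"
    and not_odd_zero: "\<And>k. m s t = enat k \<Longrightarrow> odd k \<Longrightarrow> q s = 0 \<longleftrightarrow> q t = 0"
begin

definition Q :: "'s \<Rightarrow> 'k alg_closure" where "Q u = to_ac (q u)"

text \<open>\<open>X\<^sub>v\<close> maps \<open>y\<close> to \<open>y v\<close> times the vector with coordinates \<open>entry u v\<close>, so the scalar in
  \<open>X\<^sub>u X\<^sub>v X\<^sub>u = c X\<^sub>u\<close> is \<open>c = entry u v * entry v u\<close>. The choice \<open>entry s t = 1\<close> makes \<open>X\<^sub>s\<close> and \<open>X\<^sub>t\<close>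
  noncommuting even when \<open>c = 0\<close>. If exactly one of \<open>q\<^sub>s, q\<^sub>t\<close> is \<open>0\<close>, then \<open>c = 1\<close> gives
  \<open>X\<^sub>s (1 - X\<^sub>t) X\<^sub>s = 0\<close> (or the same with \<open>s, t\<close> exchanged), whence both braid words of length at
  least \<open>4\<close> vanish.\<close>

definition entry :: "'s \<Rightarrow> 's \<Rightarrow> 'k alg_closure" where
  "entry u v =
    (if u = v then 1 + Q u
     else if u = s \<and> v = t then 1
     else if u = t \<and> v = s then
       (if Q s = 0 \<and> Q t = 0 then 0
        else if Q s = 0 \<or> Q t = 0 then 1
        else (case m s t of enat k \<Rightarrow> braid_coeff k (Q s) (Q t) | \<infinity> \<Rightarrow> 0))
     else case m u v of \<infinity> \<Rightarrow> 0
       | enat k \<Rightarrow> if odd k \<and> Q u \<noteq> 0 \<and> Q u = Q v then some_sqrt (braid_coeff k (Q u) (Q u)) else 0)"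

text \<open>The coordinate \<open>None\<close> keeps the vectors \<open>vec u\<close> nonzero, whatever the parameters are.\<close>

definition vec :: "'s \<Rightarrow> 's option \<Rightarrow> 'k alg_closure" where
  "vec v i = (case i of None \<Rightarrow> 1 | Some u \<Rightarrow> entry u v)"

definition rep :: "'s \<Rightarrow> ('s option \<Rightarrow> 'k alg_closure) \<Rightarrow> 's option \<Rightarrow> 'k alg_closure" where
  "rep u y = (\<lambda>i.
    if Q u \<noteq> 0 then y i - vec u i * y (Some u)
    else if u \<in> {s, t} then vec u i * y (Some u)
    else 0)"

lemma vec_Some [simp]: "vec v (Some u) = entry u v"
  and vec_None [simp]: "vec v None = 1"
  by (simp_all add: vec_def)

lemma entry_diag [simp]: "entry u u = 1 + Q u"
  by (simp add: entry_def)

lemma Q_eq_iff [simp]: "Q u = Q v \<longleftrightarrow> q u = q v" and Q_zero_iff [simp]: "Q u = 0 \<longleftrightarrow> q u = 0"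
  by (simp_all add: Q_def)

lemma rep_zero: "rep u 0 = 0"
  by (auto simp: rep_def fun_eq_iff)

text \<open>The diagonal entry \<open>1 + Q u\<close> gives
  \<open>X\<^sub>u\<^sup>2 = (1 + Q u) X\<^sub>u\<close>. For \<open>Q u = 0\<close> the operator is
  \<open>X\<^sub>u\<close> or \<open>0\<close>, both idempotent.\<close>

lemma rep_quadratic: "rep u (rep u y) = (\<lambda>i. (1 - Q u) * rep u y i + Q u * y i)"
  by (rule ext) (auto simp: rep_def algebra_simps simp del: Q_eq_iff)

lemma m_sym: "u \<in> S \<Longrightarrow> v \<in> S \<Longrightarrow> u \<noteq> v \<Longrightarrow> m u v = m v u"
  and m_ge_2: "u \<in> S \<Longrightarrow> v \<in> S \<Longrightarrow> u \<noteq> v \<Longrightarrow> m u v = enat k \<Longrightarrow> 2 \<le> k"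
  using matrix unfolding coxeter_matrix_def
  by (auto simp flip: numeral_eq_enat) (metis enat_ord_simps(1) numeral_eq_enat)

lemma entry_zero:
  assumes "u \<noteq> v" "{u, v} \<noteq> {s, t}" "\<And>k. m u v = enat k \<Longrightarrow> odd k \<Longrightarrow> q u = 0 \<or> q u \<noteq> q v"
  shows "entry u v = 0"
  using assms by (auto simp: entry_def split: enat.split)

lemma entry_odd:
  assumes "u \<noteq> v" "{u, v} \<noteq> {s, t}" "m u v = enat k" "odd k" "q u \<noteq> 0" "q u = q v"
  shows "entry u v = some_sqrt (braid_coeff k (Q u) (Q u))"
proof -
  have "\<not> (u = s \<and> v = t)" "\<not> (u = t \<and> v = s)"
    using assms(2) by (simp_all add: doubleton_eq_iff)
  moreover have "Q u \<noteq> 0" "Q u = Q v" using assms by simp_all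
  ultimately show ?thesis
    unfolding entry_def using assms(1,3,4) by (simp only: if_False if_True enat.case simp_thms)
qed

text \<open>The assumptions \<open>order\<close> and \<open>order'\<close> merely choose which
  generator is called \<open>u\<close>; \<open>braid_rep\<close> removes them by symmetry.\<close>

lemma braid_aux:
  assumes uv: "u \<in> S" "v \<in> S" "u \<noteq> v" "m u v = enat k" and order: "q u = 0 \<or> q v \<noteq> 0"
    and order': "q u = 0 \<Longrightarrow> q v = 0 \<Longrightarrow> v \<notin> {s, t} \<Longrightarrow> u \<notin> {s, t}"
  shows "foldr rep (alt_word u v k) y = foldr rep (alt_word v u k) y"
proof -
  have vu: "m v u = enat k" using m_sym[OF uv(1-3)] uv(4) by simp
  have k2: "2 \<le> k" by (rule m_ge_2[OF uv])
  have st_pair: "q s = 0 \<and> q t = 0 \<or> even k \<or> q s \<noteq> 0 \<and> q t \<noteq> 0" "3 \<le> k" "m s t = enat k"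
    if "{u, v} = {s, t}"
  proof -
    show mk: "m s t = enat k" using that uv(4) vu by (auto simp: doubleton_eq_iff)
    show "3 \<le> k" using m_ge mk by (simp add: numeral_eq_enat)
    show "q s = 0 \<and> q t = 0 \<or> even k \<or> q s \<noteq> 0 \<and> q t \<noteq> 0"
      using not_odd_zero[OF mk] by auto
  qed
  consider
    (kill) "q u = 0" "u \<notin> {s, t}"
  | (absorb) "q u = 0" "u \<in> {s, t}" "q v \<noteq> 0" "{u, v} \<noteq> {s, t}"
  | (mixed) "q u = 0" "q v \<noteq> 0" "{u, v} = {s, t}"
  | (zero) "q u = 0" "q v = 0" "{u, v} = {s, t}"
  | (pair) "q u \<noteq> 0" "q v \<noteq> 0" "{u, v} = {s, t}"
  | (odd) "q u \<noteq> 0" "q v \<noteq> 0" "{u, v} \<noteq> {s, t}" "odd k"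
  | (even) "q u \<noteq> 0" "q v \<noteq> 0" "{u, v} \<noteq> {s, t}" "even k"
    using order order' uv(3) by (cases "q u = 0"; cases "q v = 0") auto
  then show ?thesis
  proof cases
    case kill
    then have "rep u y = 0" for y by (auto simp: rep_def fun_eq_iff)
    then show ?thesis by (intro alt_word_absorb k2) (simp_all add: rep_zero)
  next
    case absorb
    \<comment> \<open>\<open>X\<^sub>u\<close> and \<open>X\<^sub>v\<close> annihilate each other,
      so \<open>1 - X\<^sub>v\<close> acts as the identity on either side of the idempotent
      \<open>X\<^sub>u\<close>.\<close>
    have "entry u v = 0" "entry v u = 0"
      using absorb uv(3) by (auto intro!: entry_zero)
    with absorb uv(3) show ?thesis
      by (intro alt_word_absorb k2) (auto simp: rep_def fun_eq_iff simp del: Q_eq_iff)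
  next
    case mixed
    \<comment> \<open>Odd \<open>k\<close> is excluded by \<open>not_odd_zero\<close>, so
      \<open>3 \<le> k\<close> improves to the bound needed for the word starting with
      \<open>v\<close>.\<close>
    have "even k" using st_pair(1)[OF mixed(3)] mixed by (auto simp: doubleton_eq_iff)
    with st_pair(2)[OF mixed(3)] have k4: "4 \<le> k" by (cases "k = 3") auto
    have "entry u v * entry v u = 1"
      using mixed st by (auto simp: entry_def doubleton_eq_iff)
    then have nil: "rep u (rep v (rep u y)) = 0" for y
      using mixed by (auto simp: rep_def fun_eq_iff algebra_simps)
    show ?thesis
      using alt_word_zero[OF nil rep_zero rep_zero, of k] k4 by simp
  next
    case zero
    have uv_st: "u \<in> {s, t}" "v \<in> {s, t}" using zero(3) by auto
    have rep_eq: "rep u y = (\<lambda>i. vec u i * y (Some u))" "rep v y = (\<lambda>i. vec v i * y (Some v))" for y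
      using zero(1,2) uv_st by (simp_all add: rep_def)
    \<comment> \<open>With \<open>c = 0\<close> both \<open>X\<^sub>u X\<^sub>v X\<^sub>u\<close>
      and \<open>X\<^sub>v X\<^sub>u X\<^sub>v\<close> vanish, so length \<open>3\<close> suffices
      for both words.\<close>
    have "entry u v * entry v u = 0"
      using zero st by (auto simp: entry_def doubleton_eq_iff)
    then have nil: "rep u (rep v (rep u y)) = 0" "rep v (rep u (rep v y)) = 0" for y
      unfolding rep_eq by (auto simp: fun_eq_iff)
    show ?thesis
      using alt_word_zero(1)[OF nil(1) rep_zero rep_zero, of k]
        alt_word_zero(1)[OF nil(2) rep_zero rep_zero, of k] st_pair(2)[OF zero(3)] by simp
  next
    case pair
    have root: "poly (recur_poly (if even k then 0 else Q s) (Q s * Q t) ((k - 1) div 2))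
        (entry s t * entry t s - Q s - Q t) = 0"
      using braid_coeff[OF st_pair(2)[OF pair(3)], of "Q s" "Q t"] pair st
        st_pair(3)
      by (auto simp: entry_def doubleton_eq_iff)
    \<comment> \<open>The order \<open>s, t\<close> is the one in which \<open>entry\<close> uses
      \<open>braid_coeff\<close>.\<close>
    interpret rank_two rep s t "vec s" "vec t" "Some s" "Some t" "Q s" "Q t"
      using pair by unfold_locales (auto simp: rep_def doubleton_eq_iff)
    have "odd k \<Longrightarrow> q s = q t"
      using collapse_free s t st st_pair(3)[OF pair(3)] pair
      unfolding collapse_free_def doubleton_eq_iff by metis
    then have "foldr rep (alt_word s t k) y = foldr rep (alt_word t s k) y"
      using root k2 by (intro alt_word_eq) (simp_all add: mult.commute)
    with pair(3) show ?thesis by (auto simp: doubleton_eq_iff)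
  next
    case odd
    have q: "q u = q v"
      using collapse_free uv odd unfolding collapse_free_def by metis
    have "entry u v = some_sqrt (braid_coeff k (Q u) (Q u))"
      "entry v u = some_sqrt (braid_coeff k (Q v) (Q v))"
      using uv(3) odd(1-3) q by (auto intro!: entry_odd[OF _ _ _ \<open>odd k\<close>] uv(4) vu)
    then have *: "entry u v * entry v u = braid_coeff k (Q u) (Q v)"
      using some_sqrt[of "braid_coeff k (Q u) (Q u)"] q by (simp add: Q_def)
    have "3 \<le> k" using k2 odd(4) by (cases "k = 2") auto
    interpret rank_two rep u v "vec u" "vec v" "Some u" "Some v" "Q u" "Q v"
      using odd by unfold_locales (auto simp: rep_def)
    show ?thesis
      using braid_coeff[OF \<open>3 \<le> k\<close>, of "Q u" "Q v"] k2 q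
      by (intro alt_word_eq) (simp_all add: * mult.commute[of "entry v u"])
  next
    case even
    have "entry u v = 0" "entry v u = 0"
      using even uv vu by (auto intro!: entry_zero)
    with even have "rep u (rep v y) = rep v (rep u y)" for y
      by (auto simp: rep_def fun_eq_iff simp del: Q_eq_iff)
    then show ?thesis using even by (intro alt_word_commute)
  qed
qed

lemma braid_rep:
  assumes "u \<in> S" "v \<in> S" "u \<noteq> v" "m u v = enat k"
  shows "foldr rep (alt_word u v k) y = foldr rep (alt_word v u k) y"
proof -
  have "m v u = enat k" using m_sym[OF assms(1-3)] assms(4) by simp
  then show ?thesis
    using braid_aux[OF assms] braid_aux[of v u k] assms by (metis (full_types))
qed

sublocale free_algebra_rep "\<lambda>c y i. to_ac c * y i" rep
proof unfold_locales
  show "rep u (\<lambda>i. to_ac c * y i) = (\<lambda>i. to_ac c * rep u y i)" for u c y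
    by (auto simp: rep_def fun_eq_iff algebra_simps)
qed (auto simp: fun_eq_iff rep_def algebra_simps)

text \<open>\<open>X\<^sub>s\<close> kills \<open>e\<close>, while \<open>X\<^sub>t\<close> maps it
  to \<open>vec t\<close>, which \<open>X\<^sub>s\<close> maps to \<open>vec s\<close> because
  \<open>entry s t = 1\<close>. The commutator is that of \<open>X\<^sub>s\<close> and
  \<open>X\<^sub>t\<close> up to sign, and \<open>None\<close> detects \<open>vec s\<close>.\<close>

lemma rep_not_commute:
  defines "e \<equiv> \<lambda>i. if i = Some t then 1 else 0"
  shows "rep s (rep t e) \<noteq> rep t (rep s e)"
proof -
  have "entry s t = 1" by (simp add: entry_def st)
  then have "rep s (rep t e) None \<noteq> rep t (rep s e) None"
    using st by (auto simp: rep_def e_def)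
  then show ?thesis by metis
qed

lemma annihilator_ideal: "ideal {p \<in> carrier (free_algebra S). \<forall>x. act p x = 0} (free_algebra S)"
proof -
  interpret A: submonoid_algebra "{w. letters w \<in> lists S}" "free_algebra S :: ('k, _) module"
    by (rule free_submonoid_algebra)
  show ?thesis
    unfolding A.ideal_iff by (auto simp: act_add act_mult additive.zero[OF additive_act'])
qed

lemma hecke_relations_act:
  assumes "p \<in> hecke_relations S m q"
  shows "act p x = 0"
proof -
  from assms consider
    u where "p = (free_gen u - 1) * (free_gen u + Poly_Mapping.single 0 (q u))"
  | u v k where "p = prod_list (map free_gen (alt_word u v k)) - prod_list (map free_gen (alt_word v u k))"
      "u \<in> S" "v \<in> S" "u \<noteq> v" "m u v = enat k"
    unfolding hecke_relations_def by blast
  then show ?thesis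
  proof cases
    case 1
    have "act p x = rep u (rep u x) + rep u (\<lambda>i. to_ac (q u) * x i) - (rep u x + (\<lambda>i. to_ac (q u) * x i))"
      by (simp add: 1 act_mult act_diff act_add act_const additive.add[OF additive_act']
          module_hom.add[OF rep_hom] del: act_single)
    also have "rep u (\<lambda>i. to_ac (q u) * x i) = (\<lambda>i. to_ac (q u) * rep u x i)"
      by (rule module_hom.scale[OF rep_hom])
    finally show ?thesis
      by (auto simp: rep_quadratic fun_eq_iff Q_def algebra_simps)
  next
    case 2
    show ?thesis using braid_rep[OF 2(2-5)] by (simp add: 2(1) act_diff act_word)
  qed
qed

lemma commutator_not_in_ideal:
  "free_gen s * free_gen t - free_gen t * free_gen s \<notin> genideal (free_algebra S) (hecke_relations S m q)"
proof
  assume in_ideal: "free_gen s * free_gen t - free_gen t * free_gen s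
    \<in> genideal (free_algebra S) (hecke_relations S m q)"
  interpret A: submonoid_algebra "{w. letters w \<in> lists S}" "free_algebra S :: ('k, _) module"
    by (rule free_submonoid_algebra)
  have "genideal (free_algebra S) (hecke_relations S m q)
      \<subseteq> {p \<in> carrier (free_algebra S). \<forall>x. act p x = 0}"
    using hecke_relations_act hecke_relations_closed[of S m q]
    by (intro A.genideal_minimal annihilator_ideal) auto
  with in_ideal have "act (free_gen s * free_gen t - free_gen t * free_gen s) x = 0" for x
    by blast
  then show False
    using rep_not_commute by (simp add: act_diff act_mult)
qed

end

section \<open>The abelianisation of the free algebra\<close>

lemma additive_ev: "additive (ev y)"
  by (simp add: additive_def ev_add)

lemma ev_word: "ev y (prod_list (map z l)) = prod_list (map (\<lambda>s. ev y (z s)) l)"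
  by (induction l) (simp_all add: ev_mult)

lemma ev_ev: "ev y (ev z p) = ev (\<lambda>s. ev y (z s)) p"
proof (rule additive_eqI[where p = p])
  show "additive (\<lambda>p. ev y (ev z p))"
    by (simp add: additive_def ev_add)
  fix w c
  have "ev y (ev z (Poly_Mapping.single w c)) =
      Poly_Mapping.single 0 c * prod_list (map (\<lambda>s. ev y (z s)) (letters w))"
    by (simp only: ev_single[of z] ev_mult ev_const ev_word)
  then show "ev y (ev z (Poly_Mapping.single w c)) = ev (\<lambda>s. ev y (z s)) (Poly_Mapping.single w c)"
    by (simp only: ev_single)
qed (rule additive_ev)

lemma single_word: "Poly_Mapping.single (Word l) c = Poly_Mapping.single 0 c * prod_list (map free_gen l)"
proof -
  have "prod_list (map free_gen l) = (Poly_Mapping.single (Word l) 1 :: 'a free_monoid \<Rightarrow>\<^sub>0 'b)"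
    by (induction l)
      (simp_all add: free_gen_def mult_single plus_free_monoid_def flip: single_one zero_free_monoid_def)
  then show ?thesis
    by (simp add: mult_single)
qed

lemma ev_free_gen: "ev free_gen p = p"
  by (rule additive_eqI[where p = p and g = "\<lambda>p. p"])
    (rule additive_ev, simp_all add: ev_single additive_def flip: single_word)

lemma (in submonoid_algebra) ev_in:
  assumes "\<And>s. s \<in> S \<Longrightarrow> y s \<in> carrier A" "p \<in> carrier (free_algebra S)"
  shows "ev y p \<in> carrier A"
proof -
  have "ev y p = (\<Sum>w\<in>Poly_Mapping.keys p. ev y (Poly_Mapping.single w (Poly_Mapping.lookup p w)))"
    by (subst (1) sum_single_keys[of p, symmetric]) (rule additive.sum[OF additive_ev])
  also have "\<dots> \<in> carrier A"
  proof (rule sum_in)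
    fix w assume "w \<in> Poly_Mapping.keys p"
    then have "letters w \<in> lists S"
      using assms(2) by (auto simp: free_algebra_def)
    then show "ev y (Poly_Mapping.single w (Poly_Mapping.lookup p w)) \<in> carrier A"
      unfolding ev_single using assms(1) by (intro mult_in const_in prod_list_in) auto
  qed
  finally show ?thesis .
qed

lemma free_gen_in: "s \<in> S \<Longrightarrow> free_gen s \<in> carrier (free_algebra S)"
  by (auto simp: free_algebra_def free_gen_def)

lemma poly_var_in: "s \<in> S \<Longrightarrow> poly_var s \<in> carrier (poly_algebra S)"
  by (auto simp: poly_algebra_def poly_var_def)

section \<open>Words, their exponent vectors and the kernel of abelianisation\<close>

definition exponents :: "'s list \<Rightarrow> 's \<Rightarrow>\<^sub>0 nat" where
  "exponents l = (\<Sum>s\<leftarrow>l. Poly_Mapping.single s 1)"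

lemma exponents_simps [simp]:
  "exponents [] = 0" "exponents (s # l) = Poly_Mapping.single s 1 + exponents l"
  "exponents (l @ l') = exponents l + exponents l'"
  by (simp_all add: exponents_def)

lemma exponents_replicate: "exponents (replicate n s) = Poly_Mapping.single s n"
  by (induction n) (simp_all flip: single_add)

lemma lookup_exponents: "Poly_Mapping.lookup (exponents l) s = count (mset l) s"
  by (induction l) (auto simp: lookup_add lookup_single when_def)

lemma exponents_surj:
  assumes "Poly_Mapping.keys e \<subseteq> S"
  shows "\<exists>l\<in>lists S. exponents l = e"
proof -
  have "\<exists>l\<in>lists S. exponents l = (\<Sum>s\<in>K. Poly_Mapping.single s (f s))"
    if "finite K" "K \<subseteq> S" for K and f :: "'a \<Rightarrow> nat"
    using that
  proof (induction K)
    case empty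
    show ?case by (rule bexI[of _ "[]"]) simp_all
  next
    case (insert s K)
    then obtain l where "l \<in> lists S" "exponents l = (\<Sum>s\<in>K. Poly_Mapping.single s (f s))" by auto
    with insert show ?case
      by (intro bexI[of _ "replicate (f s) s @ l"]) (auto simp: exponents_replicate)
  qed
  from this[OF finite_keys assms, of "Poly_Mapping.lookup e"] show ?thesis
    by (simp add: sum_single_keys)
qed

lemma ev_poly_var_single:
  "ev poly_var (Poly_Mapping.single w c) = Poly_Mapping.single (exponents (letters w)) c"
proof -
  have "prod_list (map poly_var l) = (Poly_Mapping.single (exponents l) 1 :: ('a \<Rightarrow>\<^sub>0 nat) \<Rightarrow>\<^sub>0 'b)" for l
    by (induction l) (simp_all add: poly_var_def mult_single)
  then show ?thesis by (simp add: ev_single mult_single)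
qed

text \<open>A set-theoretic section of \<open>exponents\<close>, obtained by choice.\<close>

lemma word_exists:
  obtains nf where "\<And>e. Poly_Mapping.keys e \<subseteq> S \<Longrightarrow> nf e \<in> lists S"
    "\<And>e. Poly_Mapping.keys e \<subseteq> S \<Longrightarrow> exponents (nf e) = e"
proof -
  have "\<forall>e. \<exists>l. Poly_Mapping.keys e \<subseteq> S \<longrightarrow> l \<in> lists S \<and> exponents l = e"
    using exponents_surj[of _ S] by metis
  from choice[OF this] that show ?thesis by auto
qed

lemma ev_poly_var_surj:
  fixes P :: "('s \<Rightarrow>\<^sub>0 nat) \<Rightarrow>\<^sub>0 'k::field"
  assumes "P \<in> carrier (poly_algebra S)"
  shows "\<exists>p\<in>carrier (free_algebra S). ev poly_var p = P"
proof -
  obtain nf where nf: "\<And>e. Poly_Mapping.keys e \<subseteq> S \<Longrightarrow> nf e \<in> lists S"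
    "\<And>e. Poly_Mapping.keys e \<subseteq> S \<Longrightarrow> exponents (nf e) = e"
    by (rule word_exists[of S]) blast
  interpret A: submonoid_algebra "{w. letters w \<in> lists S}" "free_algebra S :: ('k, _) module"
    by (rule free_submonoid_algebra)
  have keys: "Poly_Mapping.keys e \<subseteq> S" if "e \<in> Poly_Mapping.keys P" for e
    using assms that by (auto simp: poly_algebra_def)
  let ?p = "\<Sum>e\<in>Poly_Mapping.keys P. Poly_Mapping.single (Word (nf e)) (Poly_Mapping.lookup P e)"
  have "ev poly_var ?p = (\<Sum>e\<in>Poly_Mapping.keys P. Poly_Mapping.single e (Poly_Mapping.lookup P e))"
    by (simp add: additive.sum[OF additive_ev] ev_poly_var_single nf(2) keys)
  moreover have "?p \<in> carrier (free_algebra S)"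
    using nf(1) keys by (intro A.sum_in A.single_in) auto
  ultimately show ?thesis by (auto simp: sum_single_keys)
qed

context
  fixes S :: "'s set" and I :: "('s free_monoid \<Rightarrow>\<^sub>0 'k::field) set"
  assumes I: "ideal I (free_algebra S)"
    and gens_commute: "\<And>u v. u \<in> S \<Longrightarrow> v \<in> S \<Longrightarrow>
      free_gen u * free_gen v - free_gen v * free_gen u \<in> I"
begin

interpretation A: submonoid_algebra "{w. letters w \<in> lists S}" "free_algebra S :: ('k, _) module"
  by (rule free_submonoid_algebra)

lemma word_in: "l \<in> lists S \<Longrightarrow> prod_list (map free_gen l) \<in> carrier (free_algebra S :: ('k, _) module)"
  by (rule A.prod_list_in) (auto intro: free_gen_in)

lemma gen_word_commute:
  assumes "u \<in> S" "l \<in> lists S"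
  shows "free_gen u * prod_list (map free_gen l) - prod_list (map free_gen l) * free_gen u \<in> I"
  using assms(2)
proof (induction l)
  case Nil
  then show ?case by (simp add: A.ideal_zero[OF I])
next
  case (Cons v l)
  let ?L = "prod_list (map free_gen l) :: 's free_monoid \<Rightarrow>\<^sub>0 'k"
  have "free_gen u * (free_gen v * ?L) - free_gen v * ?L * free_gen u =
     (free_gen u * free_gen v - free_gen v * free_gen u) * ?L
     + free_gen v * (free_gen u * ?L - ?L * free_gen u)"
    by (simp add: right_diff_distrib left_diff_distrib mult.assoc)
  also have "\<dots> \<in> I"
    using Cons assms(1)
    by (intro A.ideal_add[OF I] A.ideal_lmult[OF I] A.ideal_rmult[OF I] gens_commute word_in free_gen_in) auto
  finally show ?case by simp
qed

text \<open>The first letter of \<open>l\<close> is moved to the front of \<open>l'\<close> modulo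
  \<open>I\<close>; induction handles the remaining letters.\<close>

lemma word_permute:
  assumes "mset l = mset l'" "l \<in> lists S" "l' \<in> lists S"
  shows "prod_list (map free_gen l) - prod_list (map free_gen l') \<in> I"
  using assms
proof (induction l arbitrary: l')
  case Nil
  then show ?case by (simp add: A.ideal_zero[OF I])
next
  case (Cons u l)
  have "u \<in> set l'"
    using Cons.prems(1) by (metis list.set_intros(1) set_mset_mset)
  then obtain a b where l': "l' = a @ u # b" by (auto simp: in_set_conv_decomp)
  let ?W = "\<lambda>l. prod_list (map free_gen l) :: 's free_monoid \<Rightarrow>\<^sub>0 'k"
  have "?W l - ?W (a @ b) \<in> I"
    by (rule Cons.IH) (use Cons.prems l' in auto)
  moreover have "free_gen u * ?W a - ?W a * free_gen u \<in> I"
    using Cons.prems l' by (intro gen_word_commute) auto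
  moreover have "free_gen u \<in> carrier (free_algebra S)" "?W b \<in> carrier (free_algebra S)"
    using Cons.prems l' by (auto intro: word_in free_gen_in)
  ultimately have "free_gen u * (?W l - ?W (a @ b)) + (free_gen u * ?W a - ?W a * free_gen u) * ?W b \<in> I"
    by (intro A.ideal_add[OF I] A.ideal_lmult[OF I] A.ideal_rmult[OF I])
  also have "free_gen u * (?W l - ?W (a @ b)) + (free_gen u * ?W a - ?W a * free_gen u) * ?W b
      = ?W (u # l) - ?W l'"
    by (simp add: l' right_diff_distrib left_diff_distrib mult.assoc)
  finally show ?case .
qed

text \<open>Rewriting every word to a fixed word with the same exponents changes \<open>p\<close> only modulo \<open>I\<close>,
  and the rewriting factors through the abelianisation.\<close>

lemma abelianisation_kernel:
  assumes p: "p \<in> carrier (free_algebra S)" and zero: "ev poly_var p = 0"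
  shows "p \<in> I"
proof -
  obtain nf where nf: "\<And>e. Poly_Mapping.keys e \<subseteq> S \<Longrightarrow> nf e \<in> lists S"
    "\<And>e. Poly_Mapping.keys e \<subseteq> S \<Longrightarrow> exponents (nf e) = e"
    by (rule word_exists[of S]) blast
  define N :: "(('s \<Rightarrow>\<^sub>0 nat) \<Rightarrow>\<^sub>0 'k) \<Rightarrow> _" where "N = lin_ext (\<lambda>e. Poly_Mapping.single (Word (nf e)))"
  have N: "additive N"
    unfolding N_def by (rule additive_lin_ext) (simp add: additive_def single_add)
  have single: "Poly_Mapping.single w c - N (ev poly_var (Poly_Mapping.single w c)) \<in> I"
    if "w \<in> Poly_Mapping.keys p" for w c
  proof -
    obtain l where w: "w = Word l" by (cases w)
    have l: "l \<in> lists S" using that p w by (auto simp: free_algebra_def)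
    have keys: "Poly_Mapping.keys (exponents l) \<subseteq> S"
      using l by (auto simp: in_keys_iff lookup_exponents)
    have "mset l = mset (nf (exponents l))"
      by (simp add: multiset_eq_iff nf(2)[OF keys] flip: lookup_exponents)
    then have "prod_list (map free_gen l) - prod_list (map free_gen (nf (exponents l))) \<in> I"
      using l nf(1)[OF keys] by (rule word_permute)
    then have "Poly_Mapping.single 0 c * (prod_list (map free_gen l) - prod_list (map free_gen (nf (exponents l)))) \<in> I"
      by (intro A.ideal_lmult[OF I] A.const_in)
    moreover have "N (ev poly_var (Poly_Mapping.single w c)) = Poly_Mapping.single (Word (nf (exponents l))) c"
      by (simp add: w ev_poly_var_single N_def lin_ext_single)
    ultimately show ?thesis by (simp add: w single_word right_diff_distrib)
  qed
  have "additive (\<lambda>p. p - N (ev poly_var p))"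
    by (simp add: additive_def ev_add additive.add[OF N])
  from additive.sum[OF this, of "\<lambda>w. Poly_Mapping.single w (Poly_Mapping.lookup p w)" "Poly_Mapping.keys p"]
  have "p - N (ev poly_var p) = (\<Sum>w\<in>Poly_Mapping.keys p.
      Poly_Mapping.single w (Poly_Mapping.lookup p w) - N (ev poly_var (Poly_Mapping.single w (Poly_Mapping.lookup p w))))"
    by (simp add: sum_single_keys)
  also have "\<dots> \<in> I"
    by (intro A.ideal_sum[OF I] single)
  finally show ?thesis
    by (simp add: zero additive.zero[OF N])
qed

end

text \<open>The isomorphism theorem for the map to the quotient by \<open>J\<close>, whose kernel is
  \<open>I\<close>. Scalars act by constants, which \<open>\<Phi>\<close> fixes, so the ring
  isomorphism is linear.\<close>

lemma quot_algebra_iso: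
  assumes "submonoid_algebra M A" "submonoid_algebra M' B" "ideal I A" "ideal J B"
    and add: "\<And>p r. \<Phi> (p + r) = \<Phi> p + \<Phi> r" and mult: "\<And>p r. \<Phi> (p * r) = \<Phi> p * \<Phi> r"
    and const: "\<And>c. \<Phi> (Poly_Mapping.single 0 c) = Poly_Mapping.single 0 c"
    and surj: "\<Phi> ` carrier A = carrier B"
    and kernel: "\<And>p. p \<in> carrier A \<Longrightarrow> \<Phi> p \<in> J \<longleftrightarrow> p \<in> I"
  shows "\<exists>h. h \<in> algebra_iso (quot_algebra A I) (quot_algebra B J)"
proof -
  interpret A: submonoid_algebra M A by fact
  interpret B: submonoid_algebra M' B by fact
  interpret I: ideal I A by fact
  interpret J: ideal J B by fact
  define f where "f = (\<lambda>p. J +>\<^bsub>B\<^esub> \<Phi> p)"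
  have \<Phi>_in: "p \<in> carrier A \<Longrightarrow> \<Phi> p \<in> carrier B" for p
    using surj by blast
  have one: "\<Phi> 1 = 1" using const[of 1] by simp
  have "ring_hom_ring A (B Quot J) f"
  proof (rule ring_hom_ringI)
    show "ring (B Quot J)" by (rule J.quotient_is_ring)
    show "f p \<in> carrier (B Quot J)" if "p \<in> carrier A" for p
      using that \<Phi>_in by (auto simp: f_def FactRing_def A_RCOSETS_def')
    show "f (p \<otimes>\<^bsub>A\<^esub> r) = f p \<otimes>\<^bsub>B Quot J\<^esub> f r" if "p \<in> carrier A" "r \<in> carrier A" for p r
      using that \<Phi>_in J.rcoset_mult_add[of "\<Phi> p" "\<Phi> r"] by (simp add: f_def FactRing_def mult)
    show "f (p \<oplus>\<^bsub>A\<^esub> r) = f p \<oplus>\<^bsub>B Quot J\<^esub> f r" if "p \<in> carrier A" "r \<in> carrier A" for p r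
      using that \<Phi>_in J.a_rcos_sum[of "\<Phi> p" "\<Phi> r"] by (simp add: f_def FactRing_def add)
    show "f \<one>\<^bsub>A\<^esub> = \<one>\<^bsub>B Quot J\<^esub>"
      by (simp add: f_def FactRing_def one)
  qed (rule A.ring_A)
  then interpret f: ring_hom_ring A "B Quot J" f .
  have ker: "a_kernel A (B Quot J) f = I"
  proof -
    have "f p = J \<longleftrightarrow> p \<in> I" if "p \<in> carrier A" for p
      using B.rcos_eq_iff[OF \<open>ideal J B\<close> \<Phi>_in[OF that] B.zero_in] kernel[OF that]
        B.a_coset_add_zero[OF J.a_subset] by (simp add: f_def)
    moreover have "\<zero>\<^bsub>B Quot J\<^esub> = J" by (simp add: FactRing_def)
    ultimately show ?thesis
      using I.a_subset unfolding a_kernel_def' by blast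
  qed
  moreover have "f ` carrier A = carrier (B Quot J)"
    by (auto simp: f_def FactRing_def A_RCOSETS_def' image_image simp flip: surj)
  ultimately have iso: "(\<lambda>Y. the_elem (f ` Y)) \<in> ring_iso (A Quot I) (B Quot J)"
    using f.FactRing_iso_set ker by simp
  have the_f: "the_elem (f ` (I +>\<^bsub>A\<^esub> p)) = f p" if "p \<in> carrier A" for p
    using f.the_elem_simp[OF that] by (simp only: ker)
  have smult: "the_elem (f ` (c \<odot>\<^bsub>quot_algebra A I\<^esub> Y)) = c \<odot>\<^bsub>quot_algebra B J\<^esub> the_elem (f ` Y)"
    if "Y \<in> carrier (A Quot I)" for c Y
  proof -
    obtain p where p: "p \<in> carrier A" and Y: "Y = I +>\<^bsub>A\<^esub> p"
      using f.quot_mem[unfolded ker, OF \<open>Y \<in> carrier (A Quot I)\<close>] by blast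
    have "c \<odot>\<^bsub>quot_algebra A I\<^esub> Y = I +>\<^bsub>A\<^esub> (Poly_Mapping.single 0 c * p)"
      using quot_algebra_smult_rcos[OF A.zero_mem, of I p c] p I.ideal_axioms
      unfolding Y A.A_eq by simp
    moreover have "c \<odot>\<^bsub>quot_algebra B J\<^esub> f p = f (Poly_Mapping.single 0 c * p)"
      using quot_algebra_smult_rcos[OF B.zero_mem, of J "\<Phi> p" c] \<Phi>_in[OF p] J.ideal_axioms
      unfolding f_def mult const B.A_eq by simp
    ultimately show ?thesis
      by (simp add: Y the_f p)
  qed
  have "(\<lambda>Y. the_elem (f ` Y)) \<in> algebra_iso (quot_algebra A I) (quot_algebra B J)"
    using iso smult
    unfolding algebra_iso_def quot_algebra_def ring_iso_def ring_hom_def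
    by (simp add: ring.defs)
  then show ?thesis by blast
qed

section \<open>Hecke relations and graph relations\<close>

abbreviation const :: "'k::field \<Rightarrow> ('m::monoid_add \<Rightarrow>\<^sub>0 'k)" where
  "const c \<equiv> Poly_Mapping.single 0 c"

definition scaling :: "'k::field \<Rightarrow> 'k" where
  "scaling a = (if a = - 1 then 1 else 1 + a)"

lemma scaling_nonzero: "scaling a \<noteq> 0"
  by (simp add: scaling_def add_eq_0_iff)

text \<open>The change of variables between the generators \<open>T\<^sub>s\<close> of the Hecke algebra and the variables
  \<open>x\<^sub>s\<close> of the graph algebra: \<open>T\<^sub>s = x\<^sub>s\<close> if \<open>q\<^sub>s = 0\<close>, and otherwise \<open>T\<^sub>s = 1 - (1 + q\<^sub>s) x\<^sub>s\<close>,
  with the vanishing coefficient \<open>1 + q\<^sub>s\<close> replaced by \<open>1\<close> if \<open>q\<^sub>s = -1\<close>.\<close>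

definition hecke_of_var :: "('s \<Rightarrow> 'k::field) \<Rightarrow> ('s \<Rightarrow> ('m::monoid_add \<Rightarrow>\<^sub>0 'k)) \<Rightarrow> 's \<Rightarrow> ('m \<Rightarrow>\<^sub>0 'k)" where
  "hecke_of_var q x s = (if q s = 0 then x s else 1 - const (scaling (q s)) * x s)"

definition var_of_hecke :: "('s \<Rightarrow> 'k::field) \<Rightarrow> ('s \<Rightarrow> ('m::monoid_add \<Rightarrow>\<^sub>0 'k)) \<Rightarrow> 's \<Rightarrow> ('m \<Rightarrow>\<^sub>0 'k)" where
  "var_of_hecke q T s = (if q s = 0 then T s else const (1 / scaling (q s)) * (1 - T s))"

lemma const_mult_cancel: "a * b = 1 \<Longrightarrow> const a * (const b * p) = p"
  by (simp add: mult_single flip: mult.assoc)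

lemma hecke_of_var_inverse: "hecke_of_var q (var_of_hecke q T) s = T s"
  and var_of_hecke_inverse: "var_of_hecke q (hecke_of_var q x) s = x s"
  by (simp_all add: hecke_of_var_def var_of_hecke_def const_mult_cancel scaling_nonzero)

lemma ev_hecke_of_var: "ev y (hecke_of_var q x s) = hecke_of_var q (\<lambda>s. ev y (x s)) s"
  and ev_var_of_hecke: "ev y (var_of_hecke q T s) = var_of_hecke q (\<lambda>s. ev y (T s)) s"
  by (simp_all add: hecke_of_var_def var_of_hecke_def ev_diff ev_mult)

abbreviation hecke_gen :: "('s \<Rightarrow> 'k::field) \<Rightarrow> 's \<Rightarrow> (('s \<Rightarrow>\<^sub>0 nat) \<Rightarrow>\<^sub>0 'k)" where
  "hecke_gen q \<equiv> hecke_of_var q poly_var"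

abbreviation to_poly :: "('s \<Rightarrow> 'k::field) \<Rightarrow> ('s free_monoid \<Rightarrow>\<^sub>0 'k) \<Rightarrow> (('s \<Rightarrow>\<^sub>0 nat) \<Rightarrow>\<^sub>0 'k)" where
  "to_poly q \<equiv> ev (hecke_gen q)"

text \<open>The inverse change of variables turns \<open>to_poly q\<close> into plain
  abelianisation, to which its image and kernel thereby reduce.\<close>

lemma to_poly_var_of_hecke: "to_poly q (ev (var_of_hecke q free_gen) p) = ev poly_var p"
  by (simp add: ev_ev ev_var_of_hecke var_of_hecke_inverse)

lemma (in submonoid_algebra) hecke_of_var_in: "x s \<in> carrier A \<Longrightarrow> hecke_of_var q x s \<in> carrier A"
  and var_of_hecke_in: "T s \<in> carrier A \<Longrightarrow> var_of_hecke q T s \<in> carrier A"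
  by (simp_all add: hecke_of_var_def var_of_hecke_def)

lemma to_poly_image: "to_poly q ` carrier (free_algebra S) = carrier (poly_algebra S)"
proof
  interpret A: submonoid_algebra "{w. letters w \<in> lists S}" "free_algebra S :: ('b, _) module"
    by (rule free_submonoid_algebra)
  interpret B: submonoid_algebra "{e. Poly_Mapping.keys e \<subseteq> S}" "poly_algebra S :: ('b, _) module"
    by (rule poly_submonoid_algebra)
  show "to_poly q ` carrier (free_algebra S) \<subseteq> carrier (poly_algebra S)"
    by (auto intro: B.ev_in B.hecke_of_var_in poly_var_in)
  show "carrier (poly_algebra S) \<subseteq> to_poly q ` carrier (free_algebra S)"
  proof
    fix P :: "('a \<Rightarrow>\<^sub>0 nat) \<Rightarrow>\<^sub>0 'b" assume "P \<in> carrier (poly_algebra S)"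
    then obtain p where "p \<in> carrier (free_algebra S)" "ev poly_var p = P"
      using ev_poly_var_surj by blast
    then show "P \<in> to_poly q ` carrier (free_algebra S)"
      by (intro image_eqI[of _ _ "ev (var_of_hecke q free_gen) p"])
        (auto simp: to_poly_var_of_hecke intro: A.ev_in A.var_of_hecke_in free_gen_in)
  qed
qed

text \<open>The change of variables is an automorphism of the free algebra; pulling \<open>I\<close>
  back along it reduces the claim to \<open>abelianisation_kernel\<close>.\<close>

lemma to_poly_kernel:
  fixes I :: "('s free_monoid \<Rightarrow>\<^sub>0 'k::field) set"
  assumes I: "ideal I (free_algebra S)"
    and comm: "\<And>p r. p \<in> carrier (free_algebra S) \<Longrightarrow> r \<in> carrier (free_algebra S) \<Longrightarrow> p * r - r * p \<in> I"
    and p: "p \<in> carrier (free_algebra S)" "to_poly q p = 0"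
  shows "p \<in> I"
proof -
  interpret A: submonoid_algebra "{w. letters w \<in> lists S}" "free_algebra S :: ('k, _) module"
    by (rule free_submonoid_algebra)
  let ?z = "var_of_hecke q free_gen :: 's \<Rightarrow> 's free_monoid \<Rightarrow>\<^sub>0 'k"
  let ?I' = "{r \<in> carrier (free_algebra S). ev ?z r \<in> I}"
  have z: "ev ?z r \<in> carrier (free_algebra S)" if "r \<in> carrier (free_algebra S)" for r
    using that by (intro A.ev_in A.var_of_hecke_in free_gen_in)
  have I': "ideal ?I' (free_algebra S)"
    unfolding A.ideal_iff
    by (auto simp: ev_add ev_mult A.ideal_zero[OF I]
        intro: A.ideal_add[OF I] A.ideal_lmult[OF I] A.ideal_rmult[OF I] z)
  have gens: "free_gen u * free_gen v - free_gen v * free_gen u \<in> ?I'" if "u \<in> S" "v \<in> S" for u v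
    unfolding mem_Collect_eq ev_diff ev_mult ev_gen
    by (intro conjI comm A.diff_in A.mult_in A.var_of_hecke_in free_gen_in that)
  define r where "r = ev (hecke_of_var q free_gen) p"
  have r: "r \<in> carrier (free_algebra S)"
    unfolding r_def using p(1) by (intro A.ev_in A.hecke_of_var_in free_gen_in)
  have "ev ?z r = p"
    by (simp add: r_def ev_ev ev_hecke_of_var hecke_of_var_inverse ev_free_gen)
  moreover from this have "ev poly_var r = 0"
    using p(2) to_poly_var_of_hecke[of q r] by simp
  from abelianisation_kernel[OF I' gens r this] have "ev ?z r \<in> I" by simp
  ultimately show ?thesis by simp
qed

lemma prod_list_alt_word:
  fixes y :: "'s \<Rightarrow> 'a::comm_monoid_mult"
  shows "prod_list (map y (alt_word u v k)) = y u ^ ((k + 1) div 2) * y v ^ (k div 2)"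
proof (induction k arbitrary: u v)
  case (Suc k)
  have "(Suc k + 1) div 2 = Suc (k div 2)" by simp
  then show ?case by (simp add: Suc mult_ac)
qed simp

section \<open>Hecke and graph relations modulo an arbitrary ideal of the polynomial algebra\<close>

context
  fixes S :: "'s set" and K :: "(('s \<Rightarrow>\<^sub>0 nat) \<Rightarrow>\<^sub>0 'k::field) set" and q :: "'s \<Rightarrow> 'k"
  assumes K: "ideal K (poly_algebra S)"
begin

interpretation B: submonoid_algebra "{e. Poly_Mapping.keys e \<subseteq> S}" "poly_algebra S :: ('k, _) module"
  by (rule poly_submonoid_algebra)

lemma const_mult_mem_iff: "c \<noteq> 0 \<Longrightarrow> const c * p \<in> K \<longleftrightarrow> p \<in> K"
  using B.ideal_lmult[OF K, of "const c * p" "const (1 / c)"] B.ideal_lmult[OF K, of p "const c"]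
  by (auto simp: const_mult_cancel)

text \<open>The two quadratic relations differ by a nonzero constant: \<open>1\<close> if
  \<open>q s\<close> is \<open>0\<close> or \<open>- 1\<close>, and the square of
  \<open>1 + q s\<close> otherwise.\<close>

lemma quadratic_mem_iff:
  "(hecke_gen q s - 1) * (hecke_gen q s + const (q s)) \<in> K \<longleftrightarrow>
     (if q s = - 1 then (poly_var s)\<^sup>2 \<in> K else (poly_var s)\<^sup>2 - poly_var s \<in> K)"
proof -
  consider "q s = 0" | "q s = - 1" "q s \<noteq> 0" | "q s \<noteq> 0" "q s \<noteq> - 1" by blast
  then show ?thesis
  proof cases
    case 1
    then have "(hecke_gen q s - 1) * (hecke_gen q s + const (q s)) = (poly_var s)\<^sup>2 - poly_var s"
      by (simp add: hecke_of_var_def algebra_simps power2_eq_square)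
    with 1 show ?thesis by simp
  next
    case 2
    have "const (- 1) = (- 1 :: ('s \<Rightarrow>\<^sub>0 nat) \<Rightarrow>\<^sub>0 'k)"
      by (simp only: single_uminus single_one)
    with 2 have "(hecke_gen q s - 1) * (hecke_gen q s + const (q s)) = (poly_var s)\<^sup>2"
      by (simp add: hecke_of_var_def scaling_def algebra_simps power2_eq_square)
    with 2 show ?thesis by simp
  next
    case 3
    have "const (1 + q s) = (1 + const (q s) :: ('s \<Rightarrow>\<^sub>0 nat) \<Rightarrow>\<^sub>0 'k)"
      by (simp only: single_add single_one)
    with 3 have y: "hecke_gen q s = 1 - (1 + const (q s)) * poly_var s"
      by (simp add: hecke_of_var_def scaling_def)
    have "(hecke_gen q s - 1) * (hecke_gen q s + const (q s)) =
        (1 + const (q s)) * ((1 + const (q s)) * ((poly_var s)\<^sup>2 - poly_var s))"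
      unfolding y by (simp add: algebra_simps power2_eq_square)
    also have "1 + const (q s) = (const (1 + q s) :: ('s \<Rightarrow>\<^sub>0 nat) \<Rightarrow>\<^sub>0 'k)"
      by (simp only: single_add single_one)
    finally show ?thesis
      using 3 by (simp add: const_mult_mem_iff add_eq_0_iff del: single_add)
  qed
qed

lemma edge_mem_iff:
  assumes s: "s \<in> S" "q s = 0" and t: "t \<in> S" "q t \<noteq> 0"
  shows "poly_var s * poly_var t \<in> K \<longleftrightarrow> hecke_gen q s * (hecke_gen q t - 1) \<in> K"
proof -
  have "hecke_gen q s * (hecke_gen q t - 1) = const (- scaling (q t)) * (poly_var s * poly_var t)"
    using s t by (simp add: hecke_of_var_def single_uminus algebra_simps)
  then show ?thesis
    by (simp only: const_mult_mem_iff neg_equal_0_iff_equal scaling_nonzero simp_thms)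
qed

lemma hecke_gen_in: "s \<in> S \<Longrightarrow> hecke_gen q s \<in> carrier (poly_algebra S)"
  by (rule B.hecke_of_var_in) (rule poly_var_in)

text \<open>Modulo \<open>K\<close>, \<open>?a\<close> is idempotent and
  \<open>?b * (?b - 1)\<close> equals \<open>- q t\<close> times \<open>?b - 1\<close>. Hence the
  braid relation reduces to a nonzero constant times \<open>?a * (?b - 1)\<close>.\<close>

lemma odd_braid_mem_iff:
  assumes s: "s \<in> S" "q s = 0" and t: "t \<in> S" "q t \<noteq> 0" and k: "odd k" "3 \<le> k"
    and quad_s: "(hecke_gen q s - 1) * (hecke_gen q s + const (q s)) \<in> K"
    and quad_t: "(hecke_gen q t - 1) * (hecke_gen q t + const (q t)) \<in> K"
  shows "prod_list (map (hecke_gen q) (alt_word s t k)) - prod_list (map (hecke_gen q) (alt_word t s k)) \<in> K \<longleftrightarrow>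
    poly_var s * poly_var t \<in> K"
proof -
  let ?a = "hecke_gen q s" and ?b = "hecke_gen q t"
  note in_K = B.ideal_add[OF K] B.ideal_lmult[OF K] B.ideal_rmult[OF K] B.ideal_diff[OF K]
  obtain j where j: "k = 2 * j + 1" using k(1) by (rule oddE)
  \<comment> \<open>The exponent \<open>j\<close> must be positive for \<open>?a ^ j\<close> to
    reduce to \<open>?a\<close>.\<close>
  with k(2) obtain i where "j = Suc i" by (cases j) auto
  with j have i: "k = 2 * Suc i + 1" by simp
  have words: "prod_list (map (hecke_gen q) (alt_word s t k)) - prod_list (map (hecke_gen q) (alt_word t s k)) =
      ?a ^ Suc i * ?b ^ Suc i * (?a - ?b)"
    unfolding prod_list_alt_word i by (simp add: algebra_simps)
  have idem: "?a * ?a - ?a \<in> K"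
    using quad_s s by (simp add: algebra_simps)
  have "?a ^ Suc n - ?a \<in> K" for n
  proof (induction n)
    case 0
    then show ?case by (simp add: B.ideal_zero[OF K])
  next
    case (Suc n)
    have "?a ^ Suc (Suc n) - ?a = ?a * (?a ^ Suc n - ?a) + (?a * ?a - ?a)"
      by (simp add: algebra_simps)
    also have "\<dots> \<in> K" by (intro in_K Suc idem hecke_gen_in s)
    finally show ?case .
  qed
  note idem_pow = this
  have pow_b: "?b ^ n * (?b - 1) - const ((- q t) ^ n) * (?b - 1) \<in> K" for n
  proof (induction n)
    case 0
    then show ?case by (simp add: B.ideal_zero[OF K])
  next
    case (Suc n)
    have "const ((- q t) ^ Suc n) = - const (q t) * (const ((- q t) ^ n) :: ('s \<Rightarrow>\<^sub>0 nat) \<Rightarrow>\<^sub>0 'k)"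
      by (simp add: mult_single flip: single_uminus)
    then have "?b ^ Suc n * (?b - 1) - const ((- q t) ^ Suc n) * (?b - 1) =
        ?b * (?b ^ n * (?b - 1) - const ((- q t) ^ n) * (?b - 1))
        + const ((- q t) ^ n) * ((?b - 1) * (?b + const (q t)))"
      by (simp add: algebra_simps)
    also have "\<dots> \<in> K" by (intro in_K Suc quad_t hecke_gen_in t B.const_in)
    finally show ?case .
  qed
  have edge: "poly_var s * poly_var t \<in> K \<longleftrightarrow> ?a * (?b - 1) \<in> K"
    by (rule edge_mem_iff[OF s t])
  show ?thesis
  proof
    assume "poly_var s * poly_var t \<in> K"
    then have "?a * (?b - 1) \<in> K" by (simp add: edge)
    from B.ideal_diff[OF K idem this]
    have "?a ^ i * ?b ^ Suc i * ((?a * ?a - ?a) - ?a * (?b - 1)) \<in> K"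
      by (rule B.ideal_lmult[OF K]) (use s t in \<open>intro B.mult_in B.power_in hecke_gen_in\<close>)
    then show "prod_list (map (hecke_gen q) (alt_word s t k)) - prod_list (map (hecke_gen q) (alt_word t s k)) \<in> K"
      by (simp add: words algebra_simps)
  next
    assume "prod_list (map (hecke_gen q) (alt_word s t k)) - prod_list (map (hecke_gen q) (alt_word t s k)) \<in> K"
    then have "?a ^ Suc i * ?b ^ Suc i * (?a - ?b) \<in> K" by (simp only: words)
    \<comment> \<open>Corrections in \<open>K\<close> that reduce the powers of \<open>?a\<close> to
      \<open>?a\<close> and \<open>?b ^ Suc i * (?b - 1)\<close> to a constant multiple of
      \<open>?b - 1\<close>.\<close>
    moreover have "?b ^ Suc i * (?a ^ Suc (Suc i) - ?a) \<in> K" "?b ^ Suc (Suc i) * (?a ^ Suc i - ?a) \<in> K"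
      "?a * (?b ^ Suc i * (?b - 1) - const ((- q t) ^ Suc i) * (?b - 1)) \<in> K"
      using s t by (auto intro!: B.ideal_lmult[OF K] idem_pow pow_b B.power_in hecke_gen_in simp del: power_Suc)
    ultimately have "?b ^ Suc i * (?a ^ Suc (Suc i) - ?a) - ?b ^ Suc (Suc i) * (?a ^ Suc i - ?a)
        - ?a ^ Suc i * ?b ^ Suc i * (?a - ?b) - ?a * (?b ^ Suc i * (?b - 1) - const ((- q t) ^ Suc i) * (?b - 1)) \<in> K"
      by (intro B.ideal_diff[OF K])
    also have "?b ^ Suc i * (?a ^ Suc (Suc i) - ?a) - ?b ^ Suc (Suc i) * (?a ^ Suc i - ?a)
        - ?a ^ Suc i * ?b ^ Suc i * (?a - ?b) - ?a * (?b ^ Suc i * (?b - 1) - const ((- q t) ^ Suc i) * (?b - 1))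
        = const ((- q t) ^ Suc i) * (?a * (?b - 1))"
      by (simp add: algebra_simps)
    finally have "?a * (?b - 1) \<in> K"
      using t by (subst (asm) const_mult_mem_iff) auto
    then show "poly_var s * poly_var t \<in> K" by (simp add: edge)
  qed
qed

end

section \<open>Comparison of the Hecke ideal and the graph ideal\<close>

theorem proposition6p1:
  fixes W :: "('w, 'x) monoid_scheme"
    and S :: "'w set"
    and m :: "'w \<Rightarrow> 'w \<Rightarrow> enat"
    and q :: "'w \<Rightarrow> 'k::field"
  assumes "coxeter_system W S m"
    and "collapse_free S m q"
    and "\<forall>x\<in>carrier (hecke_algebra S m q). \<forall>y\<in>carrier (hecke_algebra S m q).
           x \<otimes>\<^bsub>hecke_algebra S m q\<^esub> y = y \<otimes>\<^bsub>hecke_algebra S m q\<^esub> x"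
  shows "\<exists>h. h \<in> algebra_iso (hecke_algebra S m q)
                 (graph_algebra (coxeter_graph S m) {s \<in> S. q s = -1})"
proof -
  let ?F = "free_algebra S :: ('k, 'w free_monoid \<Rightarrow>\<^sub>0 'k) module"
  let ?P = "poly_algebra S :: ('k, ('w \<Rightarrow>\<^sub>0 nat) \<Rightarrow>\<^sub>0 'k) module"
  let ?HR = "hecke_relations S m q"
  let ?GR = "graph_relations (coxeter_graph S m) {s \<in> S. q s = -1} :: (('w \<Rightarrow>\<^sub>0 nat) \<Rightarrow>\<^sub>0 'k) set"
  let ?y = "hecke_gen q"
  let ?x = "poly_var :: 'w \<Rightarrow> ('w \<Rightarrow>\<^sub>0 nat) \<Rightarrow>\<^sub>0 'k"
  define I where "I = genideal ?F ?HR"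
  define J where "J = genideal ?P ?GR"
  interpret A: submonoid_algebra "{w. letters w \<in> lists S}" ?F by (rule free_submonoid_algebra)
  interpret B: submonoid_algebra "{e. Poly_Mapping.keys e \<subseteq> S}" ?P by (rule poly_submonoid_algebra)
  have matrix: "coxeter_matrix S m"
    using assms(1) by (simp add: coxeter_system_def)
  have GR_closed: "?GR \<subseteq> carrier ?P"
    unfolding coxeter_graph_def by (rule graph_relations_closed) auto
  have I: "ideal I ?F"
    unfolding I_def by (rule A.genideal_ideal[OF hecke_relations_closed])
  have J: "ideal J ?P"
    unfolding J_def by (rule B.genideal_ideal[OF GR_closed])
  have HR: "?HR \<subseteq> I"
    unfolding I_def by (rule A.genideal_self[OF hecke_relations_closed])
  have GR: "?GR \<subseteq> J"
    unfolding J_def by (rule B.genideal_self[OF GR_closed])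
  have comm: "p * r - r * p \<in> I" if pr: "p \<in> carrier ?F" "r \<in> carrier ?F" for p r
  proof -
    interpret I: ideal I ?F by (rule I)
    have H: "hecke_algebra S m q = quot_algebra ?F I"
      by (simp add: hecke_algebra_def I_def)
    have mult: "(I +>\<^bsub>?F\<^esub> a) \<otimes>\<^bsub>hecke_algebra S m q\<^esub> (I +>\<^bsub>?F\<^esub> b) = I +>\<^bsub>?F\<^esub> (a * b)"
      if "a \<in> carrier ?F" "b \<in> carrier ?F" for a b
      using I.rcoset_mult_add[OF that] by (simp add: H quot_algebra_def ring.defs FactRing_def)
    have "I +>\<^bsub>?F\<^esub> a \<in> carrier (hecke_algebra S m q)" if "a \<in> carrier ?F" for a
      using that by (auto simp: H quot_algebra_def ring.defs FactRing_def A_RCOSETS_def')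
    then have "I +>\<^bsub>?F\<^esub> (p * r) = I +>\<^bsub>?F\<^esub> (r * p)"
      using assms(3) pr by (simp flip: mult)
    then show ?thesis
      using A.rcos_eq_iff[OF I] pr by simp
  qed
  have m_sym: "m u v = m v u" if "u \<in> S" "v \<in> S" "u \<noteq> v" for u v
    using matrix that unfolding coxeter_matrix_def by blast
  have edge: "\<exists>k. m u v = enat k \<and> odd k \<and> 3 \<le> k \<and> (q u = 0) \<noteq> (q v = 0)"
    if "u \<in> S" "v \<in> S" "u \<noteq> v" "3 \<le> m u v" for u v
  proof (rule ccontr)
    assume *: "\<not> ?thesis"
    \<comment> \<open>The negated goal supplies \<open>not_odd_zero\<close>, so the commutator lies
      outside \<open>I\<close>, contrary to \<open>comm\<close>.\<close>
    interpret hecke_pair S m q u v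
    proof
      show "q u = 0 \<longleftrightarrow> q v = 0" if "m u v = enat k" "odd k" for k
        using * that \<open>3 \<le> m u v\<close> by (auto simp: numeral_eq_enat)
    qed (use matrix assms(2) that in auto)
    show False
      using commutator_not_in_ideal comm[of "free_gen u" "free_gen v"] that
      by (simp add: I_def free_gen_in)
  qed
  have braid: "prod_list (map ?y (alt_word u v k)) - prod_list (map ?y (alt_word v u k)) \<in> K \<longleftrightarrow>
      ?x u * ?x v \<in> K"
    if K: "ideal K ?P" and quad: "\<And>s. s \<in> S \<Longrightarrow> (?y s - 1) * (?y s + const (q s)) \<in> K"
      and uv: "u \<in> S" "v \<in> S" "u \<noteq> v" "m u v = enat k" and k: "odd k" "3 \<le> k" for K u v k
  proof -
    have "3 \<le> m u v" using uv k by (simp add: numeral_eq_enat)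
    then consider "q u = 0" "q v \<noteq> 0" | "q v = 0" "q u \<noteq> 0"
      using edge[OF uv(1-3)] by blast
    then show ?thesis
    proof cases
      case 1
      then show ?thesis using odd_braid_mem_iff[OF K] uv k quad by blast
    next
      case 2
      have "prod_list (map ?y (alt_word u v k)) - prod_list (map ?y (alt_word v u k)) \<in> K \<longleftrightarrow>
          prod_list (map ?y (alt_word v u k)) - prod_list (map ?y (alt_word u v k)) \<in> K"
        using B.ideal_uminus[OF K, of "prod_list (map ?y (alt_word u v k)) - prod_list (map ?y (alt_word v u k))"]
          B.ideal_uminus[OF K, of "prod_list (map ?y (alt_word v u k)) - prod_list (map ?y (alt_word u v k))"]
        by (simp only: minus_diff_eq) blast
      also have "\<dots> \<longleftrightarrow> ?x v * ?x u \<in> K"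
        using odd_braid_mem_iff[OF K] uv k quad 2 by blast
      finally show ?thesis by (simp only: mult.commute)
    qed
  qed
  have \<Phi>_in: "to_poly q p \<in> carrier ?P" if "p \<in> carrier ?F" for p
    using to_poly_image that by blast
  have HR_J: "to_poly q r \<in> J" if r: "r \<in> ?HR" for r
  proof -
    have quad: "(?y s - 1) * (?y s + const (q s)) \<in> J" if "s \<in> S" for s
      unfolding quadratic_mem_iff[OF J]
      using GR that by (auto simp: graph_relations_def coxeter_graph_def)
    from r consider s where "s \<in> S" "r = (free_gen s - 1) * (free_gen s + const (q s))"
      | s t k where "s \<in> S" "t \<in> S" "s \<noteq> t" "m s t = enat k"
        "r = prod_list (map free_gen (alt_word s t k)) - prod_list (map free_gen (alt_word t s k))"
      unfolding hecke_relations_def by blast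
    then show ?thesis
    proof cases
      case 1
      then show ?thesis using quad by (simp add: ev_mult ev_diff ev_add)
    next
      case 2
      have r: "to_poly q r = prod_list (map ?y (alt_word s t k)) - prod_list (map ?y (alt_word t s k))"
        by (simp add: 2 ev_diff ev_word)
      show ?thesis
      proof (cases "even k")
        case True
        \<comment> \<open>Both words of even length contain each letter equally often.\<close>
        then have "to_poly q r = 0"
          unfolding r prod_list_alt_word by (auto elim!: evenE simp: mult.commute)
        then show ?thesis by (simp add: B.ideal_zero[OF J])
      next
        case False
        have "2 \<le> m s t" using matrix 2(1-3) unfolding coxeter_matrix_def by blast
        with False 2 have "3 \<le> k" by (cases "k = 2") (auto simp: numeral_eq_enat)
        then have "3 \<le> m s t" using 2 by (simp add: numeral_eq_enat)
        with 2(1-3) have "{s, t} \<in> snd (coxeter_graph S m)"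
          by (auto simp: coxeter_graph_def)
        then have "?x s * ?x t \<in> ?GR"
          unfolding graph_relations_def by blast
        then have "?x s * ?x t \<in> J" using GR by blast
        then show ?thesis
          unfolding r using braid[OF J quad] 2 False \<open>3 \<le> k\<close> by blast
      qed
    qed
  qed
  have "ideal {p \<in> carrier ?F. to_poly q p \<in> J} ?F"
    unfolding A.ideal_iff
    by (auto simp: ev_add ev_mult B.ideal_zero[OF J]
        intro: B.ideal_add[OF J] B.ideal_lmult[OF J] B.ideal_rmult[OF J] \<Phi>_in)
  then have "I \<subseteq> {p \<in> carrier ?F. to_poly q p \<in> J}"
    unfolding I_def using HR_J hecke_relations_closed[of S m q]
    by (intro A.genideal_minimal) auto
  then have I_J: "to_poly q p \<in> J" if "p \<in> I" for p
    using that by blast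
  \<comment> \<open>Proving that \<open>J\<close> lies in the image of \<open>I\<close> avoids an
    inverse homomorphism into the noncommutative free algebra. Surjectivity of
    \<open>to_poly q\<close> makes this image an ideal.\<close>
  define K where "K = to_poly q ` I"
  have K: "ideal K ?P"
    unfolding B.ideal_iff
  proof (intro conjI ballI)
    show "K \<subseteq> carrier ?P"
      using A.ideal_subset[OF I] \<Phi>_in by (auto simp: K_def)
    show "0 \<in> K"
      unfolding K_def by (rule image_eqI[of _ _ 0]) (simp_all add: A.ideal_zero[OF I])
    fix a assume "a \<in> K"
    then obtain i where i: "i \<in> I" "a = to_poly q i" by (auto simp: K_def)
    show "a + b \<in> K" if "b \<in> K" for b
      using that i A.ideal_add[OF I] unfolding K_def by (auto simp flip: ev_add)
    fix P assume "P \<in> carrier ?P"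
    then obtain p where "p \<in> carrier ?F" "P = to_poly q p"
      using to_poly_image by blast
    then show "P * a \<in> K" "a * P \<in> K"
      using i A.ideal_lmult[OF I] A.ideal_rmult[OF I] unfolding K_def by (auto simp flip: ev_mult)
  qed
  have quad_K: "(?y s - 1) * (?y s + const (q s)) \<in> K" if "s \<in> S" for s
  proof -
    have "(free_gen s - 1) * (free_gen s + const (q s)) \<in> ?HR"
      unfolding hecke_relations_def using that by blast
    then have "(free_gen s - 1) * (free_gen s + const (q s)) \<in> I"
      using HR by blast
    then show ?thesis
      unfolding K_def by (rule rev_image_eqI) (simp add: ev_mult ev_diff ev_add)
  qed
  have "?GR \<subseteq> K"
  proof
    fix r assume "r \<in> ?GR"
    then consider s where "s \<in> S" "q s = - 1" "r = (?x s)\<^sup>2"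
      | s where "s \<in> S" "q s \<noteq> - 1" "r = (?x s)\<^sup>2 - ?x s"
      | u v s t where "{u, v} = {s, t}" "s \<in> S" "t \<in> S" "s \<noteq> t" "3 \<le> m s t" "r = ?x u * ?x v"
      unfolding graph_relations_def coxeter_graph_def by auto
    then show "r \<in> K"
    proof cases
      case 1
      then show ?thesis using quad_K[of s] unfolding quadratic_mem_iff[OF K] by simp
    next
      case 2
      then show ?thesis using quad_K[of s] unfolding quadratic_mem_iff[OF K] by simp
    next
      case 3
      from edge[OF 3(2-5)] obtain k where k: "m s t = enat k" "odd k" "3 \<le> k" by blast
      have "prod_list (map free_gen (alt_word s t k)) - prod_list (map free_gen (alt_word t s k)) \<in> ?HR"
        unfolding hecke_relations_def using 3(2-4) k(1) by blast
      then have "prod_list (map free_gen (alt_word s t k)) - prod_list (map free_gen (alt_word t s k)) \<in> I"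
        using HR by blast
      then have "prod_list (map ?y (alt_word s t k)) - prod_list (map ?y (alt_word t s k)) \<in> K"
        unfolding K_def by (rule rev_image_eqI) (simp add: ev_diff ev_word)
      then have "?x s * ?x t \<in> K"
        using braid[OF K quad_K 3(2-4) k] by blast
      moreover have "r = ?x s * ?x t"
        using 3(1,6) by (auto simp: doubleton_eq_iff mult.commute)
      ultimately show ?thesis by simp
    qed
  qed
  then have J_K: "J \<subseteq> K"
    unfolding J_def by (rule B.genideal_minimal[OF K])
  have "p \<in> I" if p: "p \<in> carrier ?F" "to_poly q p \<in> J" for p
  proof -
    obtain i where i: "i \<in> I" "to_poly q p = to_poly q i"
      using p(2) J_K by (auto simp: K_def)
    \<comment> \<open>The difference lies in the kernel of \<open>to_poly q\<close>, which
      \<open>I\<close> contains by commutativity.\<close>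
    have "p - i \<in> I"
      using i p(1) A.ideal_subset[OF I]
      by (intro to_poly_kernel[OF I comm, where q = q]) (auto simp: ev_diff)
    from A.ideal_add[OF I this i(1)] show ?thesis by simp
  qed
  then have kernel: "to_poly q p \<in> J \<longleftrightarrow> p \<in> I" if "p \<in> carrier ?F" for p
    using that I_J by blast
  have "\<exists>h. h \<in> algebra_iso (quot_algebra ?F I) (quot_algebra ?P J)"
    by (rule quot_algebra_iso[OF A.submonoid_algebra_axioms B.submonoid_algebra_axioms I J
          ev_add ev_mult ev_const to_poly_image kernel])
  moreover have "graph_algebra (coxeter_graph S m) {s \<in> S. q s = -1} = quot_algebra ?P J"
    by (simp add: graph_algebra_def J_def coxeter_graph_def)
  ultimately show ?thesis
    by (simp add: hecke_algebra_def I_def)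
qed

end
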